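(* Let $1\le p<\infty$, $N,M\in\mathbb N$, and let $E\subset\mathfrak{LC}_p(\mathbb R^M)$ have $L^p_{loc}$-bounded $l$-bounds. Then $$(E,\mathcal T_1)=(E,\mathcal T_2)\qquad\text{and}\qquad \mathrm{cls}_{(\mathfrak{SC}_p(\mathbb R^M),\mathcal T_1)}(E)=\mathrm{cls}_{(\mathfrak{SC}_p(\mathbb R^M),\mathcal T_2)}(E),$$ where $\mathcal T_1$ and $\mathcal T_2$ are any of the topologies $\mathcal T_D$ ($D$ a countable dense subset of $\mathbb R^N$), $\mathcal T_\Theta$ ($\Theta$ a suitable set of moduli of continuity), $\mathcal T_B$ on $\mathfrak{SC}_p(\mathbb R^M)$; here $(E,\mathcal T_i)$ is $E$ with the induced topology, and $\mathrm{cls}_{(X,\mathcal T)}(E)$ is the closure of $E$ in $(X,\mathcal T)$.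
   Context: $B_j$ is the closed ball of radius $j$ centered at $0$ in $\mathbb R^N$. $L^p_{loc}$ is the set of functions $\mathbb R\to\mathbb R$ belonging to $L^p(I)$ for every compact interval $I$. $\mathfrak{SC}_p(\mathbb R^M)$ is the set of $f:\mathbb R\times\mathbb R^N\to\mathbb R^M$ such that: (C1) $f$ is Borel measurable; (C2) for every compact $K\subset\mathbb R^N$ there is $m^K\in L^p_{loc}$ with $|f(t,x)|\le m^K(t)$ for a.e. $t$ and all $x\in K$; (S) $f(t,\cdot)$ is continuous for a.e. $t$. $\mathfrak{LC}_p(\mathbb R^M)\subset\mathfrak{SC}_p(\mathbb R^M)$ is the set of $f$ satisfying (C1), (C2) and (L): for every compact $K\subset\mathbb R^N$ there is $l^K\in L^p_{loc}$ with $|f(t,x)-f(t,y)|\le l^K(t)|x-y|$ for a.e. $t$ and all $x,y\in K$. Functions in the same space differing only on a Lebesgue-null subset of $\mathbb R^{1+N}$ are identified. The optimal $l$-bound of $f\in\mathfrak{LC}_p(\mathbb R^M)$ on $B_j$ is $l^j_f(t)=\sup_{x,y\in B_j,\,x\ne y}|f(t,x)-f(t,y)|/|x-y|$. A set $E\subset\mathfrak{LC}_p(\mathbb R^M)$ has $L^p_{loc}$-bounded $l$-bounds if $\sup_{f\in E}\int_{-r}^r (l^j_f(t))^p\,dt<\infty$ for every $j\in\mathbb N$ and $r>0$. A suitable set of moduli of continuity is a countable set of non-decreasing continuous functions $\Theta=\{\theta^I_j:[0,\infty)\to[0,\infty)\mid j\in\mathbb N,\ I=[q_1,q_2],\ q_1,q_2\in\mathbb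 Q\}$ with $\theta^I_j(0)=0$ and $\theta^{I_1}_{j_1}\le\theta^{I_2}_{j_2}$ whenever $I_1\subseteq I_2$, $j_1\le j_2$; $\mathcal K^I_j$ is the set of continuous functions $I\to B_j$ admitting $\theta^I_j$ as modulus of continuity. Topologies on $\mathfrak{SC}_p(\mathbb R^M)$, with $I$ ranging over compact intervals with rational endpoints and $j\in\mathbb N$: $\mathcal T_B$ is generated by the seminorms $\sup_{x(\cdot)\in C(I,B_j)}\big[\int_I|f(t,x(t))|^pdt\big]^{1/p}$; $\mathcal T_\Theta$ by $\sup_{x(\cdot)\in\mathcal K^I_j}\big[\int_I|f(t,x(t))|^pdt\big]^{1/p}$; $\mathcal T_D$ ($D\subset\mathbb R^N$ countable and dense) by $\big[\int_I|f(t,x)|^pdt\big]^{1/p}$, $x\in D$. *)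

theory Defs
  imports "HOL-Analysis.Analysis"
begin

text \<open>
  Throughout, the index set \<open>\<nat>\<close> of the mathematical text is \<open>{1, 2, \<dots>}\<close>; the dimensions are
  \<open>N = CARD('n)\<close> and \<open>M = CARD('m)\<close>.
\<close>

subsection \<open>Caratheodory functions\<close>

definition Lploc :: "real \<Rightarrow> (real \<Rightarrow> real) set" where
  "Lploc p = {m. m \<in> borel_measurable lebesgue \<and>
                 (\<forall>a b. set_integrable lebesgue {a..b} (\<lambda>t. \<bar>m t\<bar> powr p))}"

definition SC :: "real \<Rightarrow> (real \<times> (real^'n) \<Rightarrow> real^'m) set" where
  "SC p = {f. f \<in> borel_measurable borel \<and>
     (\<forall>K. compact K \<longrightarrow> (\<exists>m\<in>Lploc p. AE t in lebesgue. \<forall>x\<in>K. norm (f (t, x)) \<le> m t)) \<and>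
     (AE t in lebesgue. continuous_on UNIV (\<lambda>x. f (t, x)))}"

definition LC :: "real \<Rightarrow> (real \<times> (real^'n) \<Rightarrow> real^'m) set" where
  "LC p = {f. f \<in> borel_measurable borel \<and>
     (\<forall>K. compact K \<longrightarrow> (\<exists>m\<in>Lploc p. AE t in lebesgue. \<forall>x\<in>K. norm (f (t, x)) \<le> m t)) \<and>
     (\<forall>K. compact K \<longrightarrow> (\<exists>l\<in>Lploc p. AE t in lebesgue. \<forall>x\<in>K. \<forall>y\<in>K.
         norm (f (t, x) - f (t, y)) \<le> l t * norm (x - y)))}"

subsection \<open>Identification up to null sets\<close>

definition ae_rel :: "real \<Rightarrow> ((real \<times> (real^'n) \<Rightarrow> real^'m) \<times> (real \<times> (real^'n) \<Rightarrow> real^'m)) set" where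
  "ae_rel p = {(f, g). f \<in> SC p \<and> g \<in> SC p \<and> (AE z in lebesgue. f z = g z)}"

definition SC_space :: "real \<Rightarrow> (real \<times> (real^'n) \<Rightarrow> real^'m) set set" where
  "SC_space p = SC p // ae_rel p"

definition LC_space :: "real \<Rightarrow> (real \<times> (real^'n) \<Rightarrow> real^'m) set set" where
  "LC_space p = {F \<in> SC_space p. \<exists>f\<in>F. f \<in> LC p}"

text \<open>
  Two representatives of one class agree, for almost every \<open>t\<close>, at every \<open>x\<close>. Hence every notion
  below that is computed from a representative does not depend on which one is chosen, and every
  representative of a class in \<open>LC_space p\<close> belongs to \<open>LC p\<close>.
\<close>

lemma ae_rel_imp_AE_all:
  fixes f g :: "real \<times> (real^'n) \<Rightarrow> real^'m"
  assumes "(f, g) \<in> ae_rel p"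
  shows "AE t in lebesgue. \<forall>x. f (t, x) = g (t, x)"
proof -
  have f: "AE t in lborel. continuous_on UNIV (\<lambda>x. f (t, x))"
    and g: "AE t in lborel. continuous_on UNIV (\<lambda>x. g (t, x))"
    and fg: "AE z in lborel. f z = g z"
    using assms by (auto simp: ae_rel_def SC_def AE_completion_iff)
  from fg have "AE z in lborel \<Otimes>\<^sub>M lborel. f z = g z"
    by (subst lborel_prod)
  then have "AE t in lborel. AE x in lborel. f (t, x) = g (t, x)"
    by (rule lborel_pair.AE_pair)
  with f g have "AE t in lborel. \<forall>x. f (t, x) = g (t, x)"
  proof eventually_elim
    case (elim t)
    then have "closed {x. f (t, x) = g (t, x)}"
      by (intro closed_Collect_eq)
    moreover have "AE x in lebesgue. x \<in> {x. f (t, x) = g (t, x)}"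
      using elim by (simp add: AE_completion_iff)
    ultimately show ?case
      using mem_closed_if_AE_lebesgue by blast
  qed
  then show ?thesis
    by (simp add: AE_completion_iff)
qed

definition rep :: "(real \<times> (real^'n) \<Rightarrow> real^'m) set \<Rightarrow> real \<times> (real^'n) \<Rightarrow> real^'m" where
  "rep F = (SOME f. f \<in> F)"

subsection \<open>Optimal l-bounds\<close>

text \<open>
  For \<open>f \<in> LC p\<close> the supremum is taken over a bounded set for almost every \<open>t\<close>; the value at the
  remaining \<open>t\<close> is irrelevant.
\<close>

definition l_bound :: "nat \<Rightarrow> (real \<times> (real^'n) \<Rightarrow> real^'m) \<Rightarrow> real \<Rightarrow> real" where
  "l_bound j f t = Sup {norm (f (t, x) - f (t, y)) / norm (x - y) | x y.
     x \<in> cball 0 (real j) \<and> y \<in> cball 0 (real j) \<and> x \<noteq> y}"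

definition Lploc_bounded_l_bounds :: "real \<Rightarrow> (real \<times> (real^'n) \<Rightarrow> real^'m) set set \<Rightarrow> bool" where
  "Lploc_bounded_l_bounds p E \<longleftrightarrow> (\<forall>j\<ge>1. \<forall>r>0.
     (SUP F\<in>E. \<integral>\<^sup>+t\<in>{-r..r}. ennreal (l_bound j (rep F) t powr p) \<partial>lebesgue) < \<infinity>)"

subsection \<open>Suitable sets of moduli of continuity\<close>

definition rat_intervals :: "real set set" where
  "rat_intervals = {{a..b} | a b. a \<in> \<rat> \<and> b \<in> \<rat> \<and> a \<le> b}"

text \<open>Only the values of \<open>\<theta> I j\<close> on \<open>{0..}\<close>, for \<open>I \<in> rat_intervals\<close> and \<open>j \<ge> 1\<close>, matter.\<close>

definition suitable_moduli :: "(real set \<Rightarrow> nat \<Rightarrow> real \<Rightarrow> real) \<Rightarrow> bool" where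
  "suitable_moduli \<theta> \<longleftrightarrow>
     (\<forall>I\<in>rat_intervals. \<forall>j\<ge>1. \<theta> I j ` {0..} \<subseteq> {0..} \<and> mono_on {0..} (\<theta> I j) \<and>
        continuous_on {0..} (\<theta> I j) \<and> \<theta> I j 0 = 0) \<and>
     (\<forall>I\<in>rat_intervals. \<forall>I'\<in>rat_intervals. \<forall>j\<ge>1. \<forall>j'\<ge>1. I \<subseteq> I' \<longrightarrow> j \<le> j' \<longrightarrow>
        (\<forall>s\<ge>0. \<theta> I j s \<le> \<theta> I' j' s))"

definition C_ball :: "real set \<Rightarrow> nat \<Rightarrow> (real \<Rightarrow> real^'n) set" where
  "C_ball I j = {x. continuous_on I x \<and> x ` I \<subseteq> cball 0 (real j)}"

definition K_mod :: "(real set \<Rightarrow> nat \<Rightarrow> real \<Rightarrow> real) \<Rightarrow> real set \<Rightarrow> nat \<Rightarrow> (real \<Rightarrow> real^'n) set" where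
  "K_mod \<theta> I j = {x \<in> C_ball I j. \<forall>s\<in>I. \<forall>t\<in>I. norm (x s - x t) \<le> \<theta> I j \<bar>s - t\<bar>}"

subsection \<open>Seminorms and topologies\<close>

definition Lp_along ::
  "real \<Rightarrow> real set \<Rightarrow> (real \<Rightarrow> real^'n) \<Rightarrow> (real \<times> (real^'n) \<Rightarrow> real^'m) \<Rightarrow> real" where
  "Lp_along p I x f = (LINT t:I|lebesgue. norm (f (t, x t)) powr p) powr (1 / p)"

text \<open>By (C2), the suprema below are over nonempty bounded sets for every \<open>f \<in> SC p\<close>.\<close>

definition seminorms_B :: "real \<Rightarrow> ((real \<times> (real^'n) \<Rightarrow> real^'m) \<Rightarrow> real) set" where
  "seminorms_B p = {\<lambda>f. SUP x\<in>C_ball I j. Lp_along p I x f | I j. I \<in> rat_intervals \<and> j \<ge> 1}"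

definition seminorms_Theta ::
  "real \<Rightarrow> (real set \<Rightarrow> nat \<Rightarrow> real \<Rightarrow> real) \<Rightarrow> ((real \<times> (real^'n) \<Rightarrow> real^'m) \<Rightarrow> real) set" where
  "seminorms_Theta p \<theta> =
     {\<lambda>f. SUP x\<in>K_mod \<theta> I j. Lp_along p I x f | I j. I \<in> rat_intervals \<and> j \<ge> 1}"

definition seminorms_D ::
  "real \<Rightarrow> (real^'n) set \<Rightarrow> ((real \<times> (real^'n) \<Rightarrow> real^'m) \<Rightarrow> real) set" where
  "seminorms_D p D = {\<lambda>f. Lp_along p I (\<lambda>_. x) f | I x. I \<in> rat_intervals \<and> x \<in> D}"

text \<open>The topology on \<open>SC_space p\<close> whose subbase consists of all balls of the given seminorms.\<close>

definition seminorm_topology ::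
  "real \<Rightarrow> ((real \<times> (real^'n) \<Rightarrow> real^'m) \<Rightarrow> real) set \<Rightarrow> (real \<times> (real^'n) \<Rightarrow> real^'m) set topology" where
  "seminorm_topology p S = topology_generated_by
     {{G \<in> SC_space p. \<rho> (\<lambda>z. rep G z - rep F z) < e} | \<rho> F e. \<rho> \<in> S \<and> F \<in> SC_space p \<and> e > 0}"

definition T_B :: "real \<Rightarrow> (real \<times> (real^'n) \<Rightarrow> real^'m) set topology" where
  "T_B p = seminorm_topology p (seminorms_B p)"

definition T_Theta ::
  "real \<Rightarrow> (real set \<Rightarrow> nat \<Rightarrow> real \<Rightarrow> real) \<Rightarrow> (real \<times> (real^'n) \<Rightarrow> real^'m) set topology" where
  "T_Theta p \<theta> = seminorm_topology p (seminorms_Theta p \<theta>)"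

definition T_D :: "real \<Rightarrow> (real^'n) set \<Rightarrow> (real \<times> (real^'n) \<Rightarrow> real^'m) set topology" where
  "T_D p D = seminorm_topology p (seminorms_D p D)"

definition admissible_topologies :: "real \<Rightarrow> (real \<times> (real^'n) \<Rightarrow> real^'m) set topology set" where
  "admissible_topologies p =
     {T_D p D | D. countable D \<and> closure D = UNIV} \<union>
     {T_Theta p \<theta> | \<theta>. suitable_moduli \<theta>} \<union>
     {T_B p}"

end

theory Submission
  imports Defs
begin

text \<open>
  Every seminorm of \<open>T_D\<close> is the seminorm along a constant path, and constant paths admit every
  modulus of continuity; so \<open>T_D\<close> is coarser than \<open>T_Theta\<close>, and \<open>T_Theta\<close> is coarser than \<open>T_B\<close>. What has
  to be shown is that, as far as functions \<open>g\<close> in \<open>E\<close> near a given \<open>f\<close> are concerned, \<open>T_B\<close> is not finer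
  than \<open>T_D\<close>. The point is that \<open>f\<close> may be any function of the space.

  Let a compact interval \<open>I\<close> and a ball \<open>B\<close> be given, and let \<open>N\<close> be a finite \<open>\<delta>\<close>-net of \<open>B\<close> with points in
  \<open>D\<close>. For a path \<open>x\<close> in \<open>B\<close> and a net point \<open>d\<close> within \<open>\<delta>\<close> of \<open>x t\<close>, the difference \<open>\<bar>g - f\<bar> (t, x t)\<close> is at
  most \<open>\<bar>g - f\<bar> (t, d)\<close> plus the oscillations at scale \<open>\<delta>\<close> of \<open>g (t, \<cdot>)\<close> and of \<open>f (t, \<cdot>)\<close>
  (\<open>Lp_mass_diff_le_osc\<close>). The oscillation of \<open>g\<close> is at most \<open>\<delta>\<close> times its l-bound, so its \<open>L\<^sup>p\<close> norm is
  small with \<open>\<delta>\<close>, uniformly for \<open>g\<close> in \<open>E\<close> (\<open>bounded_l_bounds_osc\<close>). The oscillation of the single function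
  \<open>f\<close> tends to 0 in \<open>L\<^sup>p\<close> by uniform continuity on compact sets and dominated convergence
  (\<open>integral_pointwise_osc_tendsto_0\<close>). With \<open>\<delta>\<close> fixed, the remaining terms are controlled by finitely
  many seminorms of \<open>T_D\<close>. This is \<open>seminorms_D_controls_seminorms_B\<close>.

  Thus for every \<open>f\<close> in the space, any two of the topologies have the same traces on \<open>E\<close> of
  neighbourhoods of \<open>f\<close>. For \<open>f\<close> in \<open>E\<close> this says that the induced topologies agree, and for arbitrary \<open>f\<close>
  that the closures agree (\<open>subtopology_closure_eq_if_controls\<close>). That the seminorm balls around \<open>f\<close> form a
  neighbourhood base of \<open>f\<close> rests on Minkowski's inequality (\<open>Lp_along_add_le\<close>).
\<close>

section \<open>Caratheodory functions and their representatives\<close>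

lemma powr_add3_le:
  fixes a b c p :: real
  assumes "0 \<le> a" "0 \<le> b" "0 \<le> c" "0 \<le> p"
  shows "(a + b + c) powr p \<le> 3 powr p * (a powr p + b powr p + c powr p)"
proof -
  define m where "m = max a (max b c)"
  have "(a + b + c) powr p \<le> (3 * m) powr p"
    using assms by (intro powr_mono2) (auto simp: m_def)
  also have "\<dots> = 3 powr p * m powr p"
    using assms by (simp add: powr_mult m_def)
  also have "m powr p \<le> a powr p + b powr p + c powr p"
    unfolding m_def by (auto simp: max_def)
  finally show ?thesis by simp
qed

lemma Lploc_add:
  assumes "1 \<le> p" "m \<in> Lploc p" "m' \<in> Lploc p"
  shows "(\<lambda>t. m t + m' t) \<in> Lploc p"
proof -
  have meas: "m \<in> borel_measurable lebesgue" "m' \<in> borel_measurable lebesgue"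
    using assms by (auto simp: Lploc_def)
  have "set_integrable lebesgue {a..b} (\<lambda>t. \<bar>m t + m' t\<bar> powr p)" for a b
  proof -
    have i: "set_integrable lebesgue {a..b} (\<lambda>t. 3 powr p * (\<bar>m t\<bar> powr p + \<bar>m' t\<bar> powr p))"
      using assms by (intro set_integrable_mult_right set_integral_add) (auto simp: Lploc_def)
    have *: "\<bar>m t + m' t\<bar> powr p \<le> 3 powr p * (\<bar>m t\<bar> powr p + \<bar>m' t\<bar> powr p)" for t
    proof -
      have "\<bar>m t + m' t\<bar> powr p \<le> (\<bar>m t\<bar> + \<bar>m' t\<bar> + 0) powr p"
        using assms(1) by (intro powr_mono2) auto
      also have "\<dots> \<le> 3 powr p * (\<bar>m t\<bar> powr p + \<bar>m' t\<bar> powr p + 0 powr p)"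
        using assms(1) by (intro powr_add3_le) auto
      finally show ?thesis by simp
    qed
    have "(\<lambda>t. indicator {a..b} t *\<^sub>R \<bar>m t + m' t\<bar> powr p) \<in> borel_measurable lebesgue"
      using meas by (intro borel_measurable_scaleR borel_measurable_indicator powr_real_measurable
          borel_measurable_abs borel_measurable_add borel_measurable_const) auto
    then show ?thesis
      by (intro set_integrable_bound[OF i]) (use * in \<open>auto simp: set_borel_measurable_def\<close>)
  qed
  moreover have "(\<lambda>t. m t + m' t) \<in> borel_measurable lebesgue"
    using meas by (rule borel_measurable_add)
  ultimately show ?thesis
    by (simp add: Lploc_def)
qed

lemma Lploc_nn_integral:
  assumes "m \<in> Lploc p"
  shows "(\<lambda>t. ennreal (\<bar>m t\<bar> powr p) * indicator {a..b} t) \<in> borel_measurable lebesgue"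
    and "(\<integral>\<^sup>+t\<in>{a..b}. ennreal (\<bar>m t\<bar> powr p) \<partial>lebesgue) < \<infinity>"
proof -
  have int: "integrable lebesgue (\<lambda>t. indicator {a..b} t * \<bar>m t\<bar> powr p)"
    using assms by (auto simp: Lploc_def set_integrable_def)
  have eq: "ennreal (norm (indicator {a..b} t * \<bar>m t\<bar> powr p)) = ennreal (\<bar>m t\<bar> powr p) * indicator {a..b} t" for t
    by (auto simp: indicator_def)
  show "(\<lambda>t. ennreal (\<bar>m t\<bar> powr p) * indicator {a..b} t) \<in> borel_measurable lebesgue"
    unfolding eq[symmetric]
    by (rule measurable_compose[OF borel_measurable_integrable[OF integrable_norm[OF int]] measurable_ennreal])
  show "(\<integral>\<^sup>+t\<in>{a..b}. ennreal (\<bar>m t\<bar> powr p) \<partial>lebesgue) < \<infinity>"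
    using int unfolding eq[symmetric] by (simp add: integrable_iff_bounded)
qed

lemma SC_measurable: "f \<in> SC p \<Longrightarrow> f \<in> borel_measurable borel"
  by (simp add: SC_def)

lemma SC_continuous: "f \<in> SC p \<Longrightarrow> AE t in lebesgue. continuous_on UNIV (\<lambda>x. f (t, x))"
  by (simp add: SC_def)

lemma SC_bounded:
  assumes "f \<in> SC p" "compact K"
  obtains m where "m \<in> Lploc p" "AE t in lebesgue. \<forall>x\<in>K. norm (f (t, x)) \<le> m t"
proof -
  have "\<exists>m\<in>Lploc p. AE t in lebesgue. \<forall>x\<in>K. norm (f (t, x)) \<le> m t"
    using assms by (simp add: SC_def)
  then show thesis using that by (elim bexE)
qed

text \<open>
  The factor is a sign, so that one dominating function for the sum serves sums and differences.
\<close>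

lemma SC_lincomb:
  fixes u v :: "real \<times> (real^'n) \<Rightarrow> real^'m"
  assumes "1 \<le> p" "u \<in> SC p" "v \<in> SC p" "\<bar>c\<bar> = 1"
  shows "(\<lambda>z. u z + c *\<^sub>R v z) \<in> SC p"
proof -
  have "(\<lambda>z. u z + c *\<^sub>R v z) \<in> borel_measurable borel"
    using assms(2,3)[THEN SC_measurable] by measurable
  moreover have "\<exists>m\<in>Lploc p. AE t in lebesgue. \<forall>x\<in>K. norm (u (t, x) + c *\<^sub>R v (t, x)) \<le> m t"
    if "compact K" for K
  proof -
    obtain m where m: "m \<in> Lploc p" "AE t in lebesgue. \<forall>x\<in>K. norm (u (t, x)) \<le> m t"
      by (rule SC_bounded[OF assms(2) \<open>compact K\<close>])
    obtain m' where m': "m' \<in> Lploc p" "AE t in lebesgue. \<forall>x\<in>K. norm (v (t, x)) \<le> m' t"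
      by (rule SC_bounded[OF assms(3) \<open>compact K\<close>])
    from m(2) m'(2) have "AE t in lebesgue. \<forall>x\<in>K. norm (u (t, x) + c *\<^sub>R v (t, x)) \<le> m t + m' t"
    proof eventually_elim
      case (elim t)
      show ?case
      proof
        fix x assume "x \<in> K"
        have "norm (u (t, x) + c *\<^sub>R v (t, x)) \<le> norm (u (t, x)) + norm (v (t, x))"
          using norm_triangle_ineq[of "u (t, x)" "c *\<^sub>R v (t, x)"] assms(4) by simp
        also have "\<dots> \<le> m t + m' t"
          using elim \<open>x \<in> K\<close> by (intro add_mono) auto
        finally show "norm (u (t, x) + c *\<^sub>R v (t, x)) \<le> m t + m' t" .
      qed
    qed
    then show ?thesis
      using Lploc_add[OF assms(1) m(1) m'(1)] by (rule bexI)
  qed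
  moreover have "AE t in lebesgue. continuous_on UNIV (\<lambda>x. u (t, x) + c *\<^sub>R v (t, x))"
  proof -
    have "AE t in lebesgue. continuous_on UNIV (\<lambda>x. u (t, x))" "AE t in lebesgue. continuous_on UNIV (\<lambda>x. v (t, x))"
      using assms(2,3)[THEN SC_continuous] by simp_all
    then show ?thesis
      by eventually_elim (intro continuous_intros)
  qed
  ultimately show ?thesis
    unfolding SC_def by simp
qed

lemma SC_diff:
  fixes u v :: "real \<times> (real^'n) \<Rightarrow> real^'m"
  assumes "1 \<le> p" "u \<in> SC p" "v \<in> SC p"
  shows "(\<lambda>z. u z - v z) \<in> SC p"
  using SC_lincomb[OF assms, of "-1"] by simp

text \<open>
  A class is the image of one element under the relation, so its chosen representative is related
  to every member by way of that element.
\<close>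

lemma rep_ae_rel:
  fixes F :: "(real \<times> (real^'n) \<Rightarrow> real^'m) set"
  assumes "F \<in> SC_space p" "f \<in> F"
  shows "(rep F, f) \<in> ae_rel p"
proof -
  obtain g where g: "g \<in> SC p" "F = ae_rel p `` {g}"
    using assms(1) unfolding SC_space_def by (auto elim: quotientE)
  have "rep F \<in> F"
    unfolding rep_def using someI[of "\<lambda>f. f \<in> F" f] assms(2) by simp
  with g assms(2) have "rep F \<in> SC p" "f \<in> SC p" "AE z in lebesgue. g z = rep F z" "AE z in lebesgue. g z = f z"
    by (auto simp: ae_rel_def)
  moreover from this(3,4) have "AE z in lebesgue. rep F z = f z"
    by eventually_elim simp
  ultimately show ?thesis
    by (auto simp: ae_rel_def)
qed

lemma rep_in_SC:
  fixes F :: "(real \<times> (real^'n) \<Rightarrow> real^'m) set"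
  assumes "F \<in> SC_space p"
  shows "rep F \<in> SC p"
proof -
  obtain g where g: "g \<in> SC p" "F = ae_rel p `` {g}"
    using assms unfolding SC_space_def by (auto elim: quotientE)
  then have "g \<in> F" by (auto simp: ae_rel_def)
  from rep_ae_rel[OF assms this] show ?thesis
    by (auto simp: ae_rel_def)
qed

section \<open>Topologies generated by seminorms\<close>

text \<open>
  The part of the notion of a seminorm from which the finite intersections of balls around a
  point form a neighbourhood base of that point. Subadditivity is restricted to \<open>SC p\<close>, where the
  suprema defining the seminorms are finite.
\<close>

definition SC_seminorm :: "real \<Rightarrow> ((real \<times> (real^'n) \<Rightarrow> real^'m) \<Rightarrow> real) \<Rightarrow> bool" where
  "SC_seminorm p \<rho> \<longleftrightarrow> \<rho> (\<lambda>z. 0) = 0 \<and>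
     (\<forall>u\<in>SC p. \<forall>v\<in>SC p. \<rho> (\<lambda>z. u z + v z) \<le> \<rho> u + \<rho> v)"

lemma SC_seminorm_add:
  "SC_seminorm p \<rho> \<Longrightarrow> u \<in> SC p \<Longrightarrow> v \<in> SC p \<Longrightarrow> \<rho> (\<lambda>z. u z + v z) \<le> \<rho> u + \<rho> v"
  by (simp add: SC_seminorm_def)

lemma SC_seminorm_triangle:
  assumes "1 \<le> p" "SC_seminorm p \<rho>" "F \<in> SC_space p" "G \<in> SC_space p" "H \<in> SC_space p"
  shows "\<rho> (\<lambda>z. rep H z - rep F z) \<le> \<rho> (\<lambda>z. rep H z - rep G z) + \<rho> (\<lambda>z. rep G z - rep F z)"
proof -
  have "\<rho> (\<lambda>z. (rep H z - rep G z) + (rep G z - rep F z)) \<le>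
      \<rho> (\<lambda>z. rep H z - rep G z) + \<rho> (\<lambda>z. rep G z - rep F z)"
    by (rule SC_seminorm_add[OF assms(2)]) (intro SC_diff[OF assms(1)] rep_in_SC assms)+
  then show ?thesis by simp
qed

lemma topspace_seminorm_topology:
  assumes "S \<noteq> {}" and S: "\<forall>\<rho>\<in>S. SC_seminorm p \<rho>"
  shows "topspace (seminorm_topology p S) = SC_space p"
proof -
  obtain \<rho> where \<rho>: "\<rho> \<in> S" using assms by auto
  have "F \<in> {G \<in> SC_space p. \<rho> (\<lambda>z. rep G z - rep F z) < 1}" if "F \<in> SC_space p" for F
    using that bspec[OF S \<rho>] by (simp add: SC_seminorm_def)
  then show ?thesis
    unfolding seminorm_topology_def topology_generated_by_topspace
    using \<rho> zero_less_one[where 'a=real] by blast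
qed

text \<open>
  Here \<open>R\<close> may be empty: then the set is the whole space, which is open because any one seminorm
  has a ball around each of its points.
\<close>

lemma openin_seminorm_ball:
  assumes "S \<noteq> {}" "\<forall>\<rho>\<in>S. SC_seminorm p \<rho>" "F \<in> SC_space p" "d > 0" "finite R" "R \<subseteq> S"
  shows "openin (seminorm_topology p S) {G \<in> SC_space p. \<forall>\<rho>\<in>R. \<rho> (\<lambda>z. rep G z - rep F z) < d}"
  using assms(5,6)
proof (induction R rule: finite_induct)
  case empty
  show ?case
    using topspace_seminorm_topology[OF assms(1,2)] openin_topspace[of "seminorm_topology p S"] by simp
next
  case (insert \<rho> R)
  have "openin (seminorm_topology p S) {G \<in> SC_space p. \<rho> (\<lambda>z. rep G z - rep F z) < d}"
    unfolding seminorm_topology_def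
    by (rule topology_generated_by_Basis) (use insert.prems assms in blast)
  then have "openin (seminorm_topology p S) ({G \<in> SC_space p. \<rho> (\<lambda>z. rep G z - rep F z) < d} \<inter>
    {G \<in> SC_space p. \<forall>\<rho>\<in>R. \<rho> (\<lambda>z. rep G z - rep F z) < d})"
    using insert by blast
  also have "{G \<in> SC_space p. \<rho> (\<lambda>z. rep G z - rep F z) < d} \<inter>
    {G \<in> SC_space p. \<forall>\<rho>\<in>R. \<rho> (\<lambda>z. rep G z - rep F z) < d} =
    {G \<in> SC_space p. \<forall>\<rho>\<in>insert \<rho> R. \<rho> (\<lambda>z. rep G z - rep F z) < d}"
    by auto
  finally show ?case .
qed

text \<open>
  The subbasic balls have arbitrary centres. By the triangle inequality a ball around \<open>F0\<close> that
  contains \<open>F\<close> contains a smaller one around \<open>F\<close>, and finite intersections and unions preserve this.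
\<close>

lemma seminorm_topology_open_contains_ball:
  assumes p: "1 \<le> p" and S: "\<forall>\<rho>\<in>S. SC_seminorm p \<rho>"
    and U: "openin (seminorm_topology p S) U" and "F \<in> U"
  shows "\<exists>R d. finite R \<and> R \<subseteq> S \<and> d > 0 \<and>
    {G \<in> SC_space p. \<forall>\<rho>\<in>R. \<rho> (\<lambda>z. rep G z - rep F z) < d} \<subseteq> U"
proof -
  have "generate_topology_on {{G \<in> SC_space p. \<rho> (\<lambda>z. rep G z - rep F z) < e} | \<rho> F e.
      \<rho> \<in> S \<and> F \<in> SC_space p \<and> e > 0} U"
    using U unfolding seminorm_topology_def by (rule openin_topology_generated_by)
  then show ?thesis using \<open>F \<in> U\<close>
  proof (induction arbitrary: F)
    case Empty
    then show ?case by simp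
  next
    case (Int U V)
    obtain R d where R: "finite R" "R \<subseteq> S" "d > 0"
        "{G \<in> SC_space p. \<forall>\<rho>\<in>R. \<rho> (\<lambda>z. rep G z - rep F z) < d} \<subseteq> U"
      using Int.IH(1)[OF IntD1[OF Int.prems]] by (elim exE conjE)
    obtain Q c where Q: "finite Q" "Q \<subseteq> S" "c > 0"
        "{G \<in> SC_space p. \<forall>\<rho>\<in>Q. \<rho> (\<lambda>z. rep G z - rep F z) < c} \<subseteq> V"
      using Int.IH(2)[OF IntD2[OF Int.prems]] by (elim exE conjE)
    show ?case
    proof (intro exI conjI)
      show "finite (R \<union> Q)" "R \<union> Q \<subseteq> S" "min d c > 0" using R Q by simp_all
      show "{G \<in> SC_space p. \<forall>\<rho>\<in>R \<union> Q. \<rho> (\<lambda>z. rep G z - rep F z) < min d c} \<subseteq> U \<inter> V"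
      proof
        fix G assume G: "G \<in> {G \<in> SC_space p. \<forall>\<rho>\<in>R \<union> Q. \<rho> (\<lambda>z. rep G z - rep F z) < min d c}"
        then have "G \<in> {G \<in> SC_space p. \<forall>\<rho>\<in>R. \<rho> (\<lambda>z. rep G z - rep F z) < d}"
          "G \<in> {G \<in> SC_space p. \<forall>\<rho>\<in>Q. \<rho> (\<lambda>z. rep G z - rep F z) < c}" by simp_all
        from set_mp[OF R(4) this(1)] set_mp[OF Q(4) this(2)] show "G \<in> U \<inter> V" ..
      qed
    qed
  next
    case (UN K)
    from UN.prems obtain U where U: "U \<in> K" "F \<in> U" by (rule UnionE)
    obtain R d where R: "finite R" "R \<subseteq> S" "d > 0"
        "{G \<in> SC_space p. \<forall>\<rho>\<in>R. \<rho> (\<lambda>z. rep G z - rep F z) < d} \<subseteq> U"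
      using UN.IH[OF U] by (elim exE conjE)
    from R(4) have "{G \<in> SC_space p. \<forall>\<rho>\<in>R. \<rho> (\<lambda>z. rep G z - rep F z) < d} \<subseteq> \<Union>K"
      using Union_upper[OF U(1)] by (rule order_trans)
    with R(1-3) show ?case by (intro exI conjI)
  next
    case (Basis s)
    then obtain \<rho> F0 e where s: "s = {G \<in> SC_space p. \<rho> (\<lambda>z. rep G z - rep F0 z) < e}"
      "\<rho> \<in> S" "F0 \<in> SC_space p" "e > 0" by (elim CollectE exE conjE)
    have F: "F \<in> SC_space p" "\<rho> (\<lambda>z. rep F z - rep F0 z) < e"
      using Basis.prems by (simp_all add: s(1))
    have "G \<in> s" if "G \<in> SC_space p" "\<rho> (\<lambda>z. rep G z - rep F z) < e - \<rho> (\<lambda>z. rep F z - rep F0 z)" for G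
      using SC_seminorm_triangle[OF p bspec[OF S s(2)] s(3) F(1) that(1)] that by (simp add: s(1))
    note ball = this
    show ?case
    proof (intro exI conjI)
      show "finite {\<rho>}" "{\<rho>} \<subseteq> S" "e - \<rho> (\<lambda>z. rep F z - rep F0 z) > 0"
        using s(2) F(2) by simp_all
      show "{G \<in> SC_space p. \<forall>\<rho>'\<in>{\<rho>}. \<rho>' (\<lambda>z. rep G z - rep F z) < e - \<rho> (\<lambda>z. rep F z - rep F0 z)} \<subseteq> s"
        by (intro subsetI ball) simp_all
    qed
  qed
qed

section \<open>Comparison of families of seminorms on a set\<close>

text \<open>
  Smallness of finitely many members of \<open>S\<close> forces smallness of each member of \<open>T\<close>, but only for
  differences \<open>G - F\<close> with \<open>G \<in> E\<close>. The centre \<open>F\<close> ranges over the whole space, not only over \<open>E\<close>: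
  with \<open>F \<in> E\<close> the condition compares the induced topologies, and with general \<open>F\<close> it compares the
  points that \<open>E\<close> accumulates at.
\<close>

definition controls ::
  "real \<Rightarrow> (real \<times> (real^'n) \<Rightarrow> real^'m) set set \<Rightarrow> ((real \<times> (real^'n) \<Rightarrow> real^'m) \<Rightarrow> real) set \<Rightarrow>
     ((real \<times> (real^'n) \<Rightarrow> real^'m) \<Rightarrow> real) set \<Rightarrow> bool" where
  "controls p E S T \<longleftrightarrow> (\<forall>F\<in>SC_space p. \<forall>\<sigma>\<in>T. \<forall>e>0. \<exists>R d. finite R \<and> R \<subseteq> S \<and> d > 0 \<and>
     (\<forall>G\<in>E. (\<forall>\<rho>\<in>R. \<rho> (\<lambda>z. rep G z - rep F z) < d) \<longrightarrow> \<sigma> (\<lambda>z. rep G z - rep F z) < e))"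

lemma controls_finite:
  fixes E :: "(real \<times> (real^'n) \<Rightarrow> real^'m) set set" and F :: "(real \<times> (real^'n) \<Rightarrow> real^'m) set"
  assumes "controls p E S T" "F \<in> SC_space p" "finite R'" "R' \<subseteq> T" "e > 0"
  shows "\<exists>R d. finite R \<and> R \<subseteq> S \<and> d > 0 \<and>
     (\<forall>G\<in>E. (\<forall>\<rho>\<in>R. \<rho> (\<lambda>z. rep G z - rep F z) < d) \<longrightarrow> (\<forall>\<sigma>\<in>R'. \<sigma> (\<lambda>z. rep G z - rep F z) < e))"
  using assms(3,4)
proof (induction R' rule: finite_induct)
  case empty
  show ?case by (intro exI[of _ "{}"] exI[of _ 1]) auto
next
  case (insert \<tau> R')
  then obtain R d where R: "finite R" "R \<subseteq> S" "d > 0"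
    "\<forall>G\<in>E. (\<forall>\<rho>\<in>R. \<rho> (\<lambda>z. rep G z - rep F z) < d) \<longrightarrow> (\<forall>\<sigma>\<in>R'. \<sigma> (\<lambda>z. rep G z - rep F z) < e)"
    by auto
  obtain Q c where Q: "finite Q" "Q \<subseteq> S" "c > 0"
    "\<forall>G\<in>E. (\<forall>\<rho>\<in>Q. \<rho> (\<lambda>z. rep G z - rep F z) < c) \<longrightarrow> \<tau> (\<lambda>z. rep G z - rep F z) < e"
    using assms(1,2,5) insert.prems unfolding controls_def by (meson insert_subset)
  show ?case
    using R Q by (intro exI[of _ "R \<union> Q"] exI[of _ "min d c"]) auto
qed

lemma controls_refl:
  fixes E :: "(real \<times> (real^'n) \<Rightarrow> real^'m) set set"
  shows "controls p E S S"
  unfolding controls_def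
proof (intro ballI allI impI)
  fix F :: "(real \<times> (real^'n) \<Rightarrow> real^'m) set" and \<sigma> and e :: real
  assume "\<sigma> \<in> S" "e > 0"
  then show "\<exists>R d. finite R \<and> R \<subseteq> S \<and> d > 0 \<and>
     (\<forall>G\<in>E. (\<forall>\<rho>\<in>R. \<rho> (\<lambda>z. rep G z - rep F z) < d) \<longrightarrow> \<sigma> (\<lambda>z. rep G z - rep F z) < e)"
    by (intro exI[of _ "{\<sigma>}"] exI[of _ e]) simp
qed

lemma controls_trans:
  fixes E :: "(real \<times> (real^'n) \<Rightarrow> real^'m) set set"
  assumes "controls p E S T" "controls p E T U"
  shows "controls p E S U"
  unfolding controls_def
proof (intro ballI allI impI)
  fix F :: "(real \<times> (real^'n) \<Rightarrow> real^'m) set" and \<sigma> and e :: real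
  assume F: "F \<in> SC_space p" and "\<sigma> \<in> U" "e > 0"
  then obtain R' d' where R': "finite R'" "R' \<subseteq> T" "d' > 0"
    "\<forall>G\<in>E. (\<forall>\<rho>\<in>R'. \<rho> (\<lambda>z. rep G z - rep F z) < d') \<longrightarrow> \<sigma> (\<lambda>z. rep G z - rep F z) < e"
    using assms(2) unfolding controls_def by meson
  from controls_finite[OF assms(1) F R'(1,2,3)] R'(4)
  show "\<exists>R d. finite R \<and> R \<subseteq> S \<and> d > 0 \<and>
     (\<forall>G\<in>E. (\<forall>\<rho>\<in>R. \<rho> (\<lambda>z. rep G z - rep F z) < d) \<longrightarrow> \<sigma> (\<lambda>z. rep G z - rep F z) < e)"
    by meson
qed

lemma controls_if_dominates:
  fixes E :: "(real \<times> (real^'n) \<Rightarrow> real^'m) set set"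
  assumes "1 \<le> p" "E \<subseteq> SC_space p"
    and dom: "\<And>\<sigma>. \<sigma> \<in> T \<Longrightarrow> \<exists>\<rho>\<in>S. \<forall>f\<in>SC p. \<sigma> f \<le> \<rho> f"
  shows "controls p E S T"
  unfolding controls_def
proof (intro ballI allI impI)
  fix F :: "(real \<times> (real^'n) \<Rightarrow> real^'m) set" and \<sigma> and e :: real
  assume F: "F \<in> SC_space p" and "\<sigma> \<in> T" "e > 0"
  then obtain \<rho> where \<rho>: "\<rho> \<in> S" "\<forall>f\<in>SC p. \<sigma> f \<le> \<rho> f" using dom by blast
  have "(\<lambda>z. rep G z - rep F z) \<in> SC p" if "G \<in> E" for G
    using that assms F by (intro SC_diff rep_in_SC) auto
  then show "\<exists>R d. finite R \<and> R \<subseteq> S \<and> d > 0 \<and>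
     (\<forall>G\<in>E. (\<forall>\<rho>\<in>R. \<rho> (\<lambda>z. rep G z - rep F z) < d) \<longrightarrow> \<sigma> (\<lambda>z. rep G z - rep F z) < e)"
    using \<rho> \<open>e > 0\<close> by (intro exI[of _ "{\<rho>}"] exI[of _ e]) (auto intro: le_less_trans)
qed

text \<open>
  On \<open>E\<close>, a \<open>T\<close>-neighbourhood of any point of the space (which may lie outside \<open>E\<close>) contains an
  \<open>S\<close>-neighbourhood. This gives both the comparison of induced topologies and that of closures.
\<close>

lemma controls_open:
  fixes S T :: "((real \<times> (real^'n) \<Rightarrow> real^'m) \<Rightarrow> real) set"
  assumes p: "1 \<le> p" and S: "S \<noteq> {}" "\<forall>\<rho>\<in>S. SC_seminorm p \<rho>"
    and T: "\<forall>\<rho>\<in>T. SC_seminorm p \<rho>"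
    and E: "E \<subseteq> SC_space p" "controls p E S T"
    and U: "openin (seminorm_topology p T) U" and F: "F \<in> U" "F \<in> SC_space p"
  shows "\<exists>V. openin (seminorm_topology p S) V \<and> F \<in> V \<and> V \<inter> E \<subseteq> U"
proof -
  obtain R' e where R': "finite R'" "R' \<subseteq> T" "e > 0"
    "{G \<in> SC_space p. \<forall>\<rho>\<in>R'. \<rho> (\<lambda>z. rep G z - rep F z) < e} \<subseteq> U"
    using seminorm_topology_open_contains_ball[OF p T U F(1)] by (elim exE conjE)
  obtain R d where R: "finite R" "R \<subseteq> S" "d > 0"
     "\<forall>G\<in>E. (\<forall>\<rho>\<in>R. \<rho> (\<lambda>z. rep G z - rep F z) < d) \<longrightarrow> (\<forall>\<sigma>\<in>R'. \<sigma> (\<lambda>z. rep G z - rep F z) < e)"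
    using controls_finite[OF E(2) F(2) R'(1,2,3)] by (elim exE conjE)
  let ?V = "{G \<in> SC_space p. \<forall>\<rho>\<in>R. \<rho> (\<lambda>z. rep G z - rep F z) < d}"
  have "openin (seminorm_topology p S) ?V"
    by (rule openin_seminorm_ball[OF S F(2) R(3,1,2)])
  moreover have "F \<in> ?V"
  proof -
    have "\<rho> (\<lambda>z. rep F z - rep F z) < d" if "\<rho> \<in> R" for \<rho>
    proof -
      have "SC_seminorm p \<rho>" using that R(2) S(2) by blast
      then show ?thesis using R(3) by (simp add: SC_seminorm_def)
    qed
    then show ?thesis using F(2) by (intro CollectI conjI ballI)
  qed
  moreover have "?V \<inter> E \<subseteq> U"
  proof
    fix G assume "G \<in> ?V \<inter> E"
    then have "G \<in> {G \<in> SC_space p. \<forall>\<rho>\<in>R'. \<rho> (\<lambda>z. rep G z - rep F z) < e}"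
      using R(4) by simp
    then show "G \<in> U" using R'(4) by (rule set_mp[rotated])
  qed
  ultimately show ?thesis by (intro exI conjI)
qed

lemma subtopology_closure_eq_if_controls:
  fixes S T :: "((real \<times> (real^'n) \<Rightarrow> real^'m) \<Rightarrow> real) set"
  assumes p: "1 \<le> p" and S: "S \<noteq> {}" "\<forall>\<rho>\<in>S. SC_seminorm p \<rho>"
    and T: "T \<noteq> {}" "\<forall>\<rho>\<in>T. SC_seminorm p \<rho>"
    and E: "E \<subseteq> SC_space p" and ST: "controls p E S T" and TS: "controls p E T S"
  shows "subtopology (seminorm_topology p S) E = subtopology (seminorm_topology p T) E"
    and "seminorm_topology p S closure_of E = seminorm_topology p T closure_of E"
proof -
  have open_sub: "openin (subtopology (seminorm_topology p S) E) W"
    if S: "S \<noteq> {}" "\<forall>\<rho>\<in>S. SC_seminorm p \<rho>" and T: "\<forall>\<rho>\<in>T. SC_seminorm p \<rho>"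
      and ST: "controls p E S T" and W: "openin (subtopology (seminorm_topology p T) E) W"
    for S T :: "((real \<times> (real^'n) \<Rightarrow> real^'m) \<Rightarrow> real) set" and W
  proof -
    obtain U where U: "openin (seminorm_topology p T) U" "W = U \<inter> E"
      using W by (auto simp: openin_subtopology)
    show ?thesis
      unfolding openin_subopen[of _ W]
    proof
      fix F assume F: "F \<in> W"
      then have "F \<in> U" "F \<in> SC_space p" using U(2) E by blast+
      then obtain V where V: "openin (seminorm_topology p S) V" "F \<in> V" "V \<inter> E \<subseteq> U"
        using controls_open[OF p S T E ST U(1) \<open>F \<in> U\<close> \<open>F \<in> SC_space p\<close>] by (elim exE conjE)
      have "openin (subtopology (seminorm_topology p S) E) (V \<inter> E)"
        using V(1) unfolding openin_subtopology by blast
      moreover have "F \<in> V \<inter> E" "V \<inter> E \<subseteq> W"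
        using V(2,3) F U(2) by blast+
      ultimately show "\<exists>V'. openin (subtopology (seminorm_topology p S) E) V' \<and> F \<in> V' \<and> V' \<subseteq> W"
        by blast
    qed
  qed
  show "subtopology (seminorm_topology p S) E = subtopology (seminorm_topology p T) E"
    unfolding topology_eq
  proof (intro allI iffI)
    fix W
    show "openin (subtopology (seminorm_topology p T) E) W"
      if "openin (subtopology (seminorm_topology p S) E) W"
      by (rule open_sub[OF T S(2) TS that])
    show "openin (subtopology (seminorm_topology p S) E) W"
      if "openin (subtopology (seminorm_topology p T) E) W"
      by (rule open_sub[OF S T(2) ST that])
  qed
  have cl_sub: "seminorm_topology p S closure_of E \<subseteq> seminorm_topology p T closure_of E"
    if S: "S \<noteq> {}" "\<forall>\<rho>\<in>S. SC_seminorm p \<rho>"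
      and T: "T \<noteq> {}" "\<forall>\<rho>\<in>T. SC_seminorm p \<rho>" and ST: "controls p E S T"
    for S T :: "((real \<times> (real^'n) \<Rightarrow> real^'m) \<Rightarrow> real) set"
  proof
    fix F assume F: "F \<in> seminorm_topology p S closure_of E"
    then have FS: "F \<in> SC_space p"
      using topspace_seminorm_topology[OF S] by (simp add: in_closure_of)
    have "\<exists>G. G \<in> E \<and> G \<in> U" if U: "F \<in> U" "openin (seminorm_topology p T) U" for U
    proof -
      obtain V where "openin (seminorm_topology p S) V" "F \<in> V" "V \<inter> E \<subseteq> U"
        using controls_open[OF p S T(2) E ST U(2) U(1) FS] by (elim exE conjE)
      moreover from this(1,2) obtain G where "G \<in> E" "G \<in> V" using F unfolding in_closure_of by blast
      ultimately show ?thesis by blast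
    qed
    then show "F \<in> seminorm_topology p T closure_of E"
      using FS topspace_seminorm_topology[OF T] unfolding in_closure_of by blast
  qed
  show "seminorm_topology p S closure_of E = seminorm_topology p T closure_of E"
    by (intro equalityI cl_sub[OF S T ST] cl_sub[OF T S TS])
qed

section \<open>Integrals along paths and Minkowski's inequality\<close>

text \<open>
  The \<open>p\<close>-th power of \<open>Lp_along\<close>, but with values in \<open>ennreal\<close>: an infinite integral shows up as \<open>\<infinity>\<close>
  instead of the default value 0 of the Bochner integral.
\<close>

definition Lp_mass ::
  "real \<Rightarrow> real set \<Rightarrow> (real \<Rightarrow> real^'n) \<Rightarrow> (real \<times> (real^'n) \<Rightarrow> real^'m) \<Rightarrow> ennreal" where
  "Lp_mass p I x f = (\<integral>\<^sup>+t\<in>I. ennreal (norm (f (t, x t)) powr p) \<partial>lebesgue)"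

lemma borel_measurable_lebesgueI:
  "f \<in> borel_measurable borel \<Longrightarrow> f \<in> borel_measurable lebesgue"
  by (rule measurable_completion) simp

text \<open>
  The path is constrained on \<open>{a..b}\<close> only, and outside it may fail to be measurable; replacing it
  there by 0 does not change the product with the indicator.
\<close>

lemma borel_measurable_along:
  fixes f :: "real \<times> (real^'n) \<Rightarrow> real^'m"
  assumes [measurable]: "f \<in> borel_measurable borel" and x: "continuous_on {a..b} x"
  shows "(\<lambda>t. indicator {a..b} t * norm (f (t, x t)) powr p) \<in> borel_measurable lebesgue"
proof -
  have [measurable]: "(\<lambda>t. indicator {a..b} t *\<^sub>R x t) \<in> borel_measurable borel"
    by (rule borel_measurable_continuous_on_indicator) (use x in auto)
  have "(\<lambda>t. indicator {a..b} t * norm (f (t, indicator {a..b} t *\<^sub>R x t)) powr p) \<in> borel_measurable borel"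
    by measurable
  also have "(\<lambda>t. indicator {a..b} t * norm (f (t, indicator {a..b} t *\<^sub>R x t)) powr p) =
    (\<lambda>t. indicator {a..b} t * norm (f (t, x t)) powr p)"
    by (auto simp: indicator_def)
  finally show ?thesis
    by (rule borel_measurable_lebesgueI)
qed

lemma ennreal_indicator_mult:
  "ennreal (indicator A t * c) = ennreal c * indicator A t"
  by (auto simp: indicator_def)

lemma borel_measurable_along_ennreal:
  fixes f :: "real \<times> (real^'n) \<Rightarrow> real^'m"
  assumes "f \<in> borel_measurable borel" "continuous_on {a..b} x"
  shows "(\<lambda>t. ennreal (norm (f (t, x t)) powr p) * indicator {a..b} t) \<in> borel_measurable lebesgue"
  unfolding ennreal_indicator_mult[symmetric]
  by (intro measurable_compose[OF borel_measurable_along measurable_ennreal] assms)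

lemma Lp_along_eq_Lp_mass:
  fixes f :: "real \<times> (real^'n) \<Rightarrow> real^'m"
  assumes "f \<in> borel_measurable borel" "continuous_on {a..b} x"
  shows "Lp_along p {a..b} x f = enn2real (Lp_mass p {a..b} x f) powr (1 / p)"
proof -
  have "(LINT t:{a..b}|lebesgue. norm (f (t, x t)) powr p) = enn2real (Lp_mass p {a..b} x f)"
    unfolding set_lebesgue_integral_def Lp_mass_def ennreal_indicator_mult[symmetric] real_scaleR_def
    by (intro integral_eq_nn_integral borel_measurable_along assms) auto
  then show ?thesis by (simp add: Lp_along_def)
qed

lemma Lp_along_le_iff:
  fixes f :: "real \<times> (real^'n) \<Rightarrow> real^'m"
  assumes "f \<in> borel_measurable borel" "continuous_on {a..b} x" "0 < p" "Lp_mass p {a..b} x f < \<infinity>" "0 \<le> A"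
  shows "Lp_along p {a..b} x f \<le> A \<longleftrightarrow> Lp_mass p {a..b} x f \<le> ennreal (A powr p)"
proof -
  obtain c where c: "Lp_mass p {a..b} x f = ennreal c" "c \<ge> 0"
    using assms(4) by (cases "Lp_mass p {a..b} x f") auto
  have "c powr (1 / p) \<le> A \<longleftrightarrow> c \<le> A powr p"
  proof
    assume "c powr (1 / p) \<le> A"
    then have "(c powr (1 / p)) powr p \<le> A powr p"
      using assms by (intro powr_mono2) auto
    then show "c \<le> A powr p" using c assms by (simp add: powr_powr)
  next
    assume "c \<le> A powr p"
    then have "c powr (1 / p) \<le> (A powr p) powr (1 / p)"
      using assms c by (intro powr_mono2) auto
    then show "c powr (1 / p) \<le> A" using assms by (simp add: powr_powr)
  qed
  then show ?thesis
    using c assms by (simp add: Lp_along_eq_Lp_mass)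
qed

text \<open>
  One dominating function on the compact ball bounds all paths in that ball at once.
\<close>

lemma SC_imp_Lp_mass_bounded:
  fixes f :: "real \<times> (real^'n) \<Rightarrow> real^'m"
  assumes "0 < p" "f \<in> SC p"
  shows "\<exists>B\<ge>0. \<forall>x\<in>C_ball {a..b} j. Lp_mass p {a..b} x f \<le> ennreal (B powr p)"
proof -
  obtain m where m: "m \<in> Lploc p" "AE t in lebesgue. \<forall>x\<in>cball 0 (real j). norm (f (t, x)) \<le> m t"
    by (rule SC_bounded[OF assms(2) compact_cball])
  define C where "C = (\<integral>\<^sup>+t\<in>{a..b}. ennreal (\<bar>m t\<bar> powr p) \<partial>lebesgue)"
  have "C < \<infinity>"
    unfolding C_def by (rule Lploc_nn_integral(2)[OF m(1)])
  then obtain c where c: "C = ennreal c" "c \<ge> 0" by (cases C) auto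
  have "Lp_mass p {a..b} x f \<le> C" if "x \<in> C_ball {a..b} j" for x
    unfolding Lp_mass_def C_def
  proof (rule nn_integral_mono_AE)
    show "AE t in lebesgue. ennreal (norm (f (t, x t)) powr p) * indicator {a..b} t
          \<le> ennreal (\<bar>m t\<bar> powr p) * indicator {a..b} t"
      using m(2)
    proof eventually_elim
      case (elim t)
      show ?case
      proof (cases "t \<in> {a..b}")
        case True
        then have "x t \<in> cball 0 (real j)" using that unfolding C_ball_def by blast
        with elim have "norm (f (t, x t)) \<le> \<bar>m t\<bar>" by force
        then have "norm (f (t, x t)) powr p \<le> \<bar>m t\<bar> powr p"
          using assms(1) by (intro powr_mono2) auto
        then show ?thesis using True by (auto intro: ennreal_leI)
      qed auto
    qed
  qed
  then show ?thesis
    using c assms(1) by (intro exI[of _ "c powr (1 / p)"]) (auto simp: powr_powr)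
qed

text \<open>
  The pointwise form of Minkowski's inequality: \<open>(a + b) / (A + B)\<close> is the convex combination of
  \<open>a / A\<close> and \<open>b / B\<close> with weights \<open>A / (A + B)\<close> and \<open>B / (A + B)\<close>, and the \<open>p\<close>-th power is convex.
\<close>

lemma powr_add_convex:
  fixes a b A B p :: real
  assumes "1 \<le> p" "0 \<le> a" "0 \<le> b" "0 < A" "0 < B"
  shows "(a + b) powr p \<le> (A + B) powr p * (A / (A + B) * (a powr p / A powr p) + B / (A + B) * (b powr p / B powr p))"
proof -
  define l where "l = A / (A + B)"
  define u where "u = a / A"
  define v where "v = b / B"
  have l: "0 < l" "l < 1" "1 - l = B / (A + B)"
    using assms by (auto simp: l_def field_simps)
  have uv: "0 \<le> u" "0 \<le> v" using assms by (auto simp: u_def v_def)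
  \<comment> \<open>\<open>powr_convex\<close> is about positive numbers; if \<open>u\<close> or \<open>v\<close> vanishes, the inequality amounts to
    \<open>c powr p \<le> c\<close> for \<open>c\<close> in the unit interval.\<close>
  have shrink: "(c * w) powr p \<le> c * w powr p" if "0 < c" "c < 1" "0 \<le> w" for c w :: real
  proof -
    have "c powr p \<le> c powr 1" using that assms(1) by (intro powr_mono') auto
    then show ?thesis using that by (simp add: powr_mult mult_right_mono)
  qed
  have conv: "(l * u + (1 - l) * v) powr p \<le> l * u powr p + (1 - l) * v powr p"
  proof (cases "u = 0 \<or> v = 0")
    case True
    then show ?thesis
      using shrink[of l u] shrink[of "1 - l" v] l uv assms(1) by auto
  next
    case False
    then show ?thesis
      using convex_onD[OF powr_convex[OF assms(1)], of "1 - l" u v] l(1,2) uv by simp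
  qed
  have "l * u = a / (A + B)" "(1 - l) * v = b / (A + B)"
    unfolding l(3) using assms by (simp_all add: l_def u_def v_def)
  then have "(a + b) = (A + B) * (l * u + (1 - l) * v)"
    using assms by (simp add: add_divide_distrib[symmetric])
  then have "(a + b) powr p = (A + B) powr p * (l * u + (1 - l) * v) powr p"
    using assms l uv by (simp add: powr_mult)
  also have "\<dots> \<le> (A + B) powr p * (l * u powr p + (1 - l) * v powr p)"
    by (intro mult_left_mono conv) auto
  finally show ?thesis
    unfolding l(3) using assms by (simp add: l_def u_def v_def powr_divide)
qed

text \<open>
  Integrating the pointwise inequality, with \<open>A\<close> and \<open>B\<close> as bounds for the two norms, makes the two
  weights add up to 1.
\<close>

lemma Lp_mass_add_le:
  fixes u v :: "real \<times> (real^'n) \<Rightarrow> real^'m"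
  assumes "1 \<le> p" and u: "u \<in> borel_measurable borel" and v: "v \<in> borel_measurable borel"
    and x: "continuous_on {a..b} x" and AB: "0 < A" "0 < B"
    and "Lp_mass p {a..b} x u \<le> ennreal (A powr p)" "Lp_mass p {a..b} x v \<le> ennreal (B powr p)"
  shows "Lp_mass p {a..b} x (\<lambda>z. u z + v z) \<le> ennreal ((A + B) powr p)"
proof -
  define \<alpha> where "\<alpha> = (A + B) powr p * (A / (A + B)) / A powr p"
  define \<beta> where "\<beta> = (A + B) powr p * (B / (A + B)) / B powr p"
  have nn: "0 \<le> \<alpha>" "0 \<le> \<beta>" using AB by (auto simp: \<alpha>_def \<beta>_def)
  have "norm (u z + v z) powr p \<le> \<alpha> * norm (u z) powr p + \<beta> * norm (v z) powr p" for z
  proof -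
    have "norm (u z + v z) powr p \<le> (norm (u z) + norm (v z)) powr p"
      using assms(1) by (intro powr_mono2 norm_triangle_ineq) auto
    also have "\<dots> \<le> \<alpha> * norm (u z) powr p + \<beta> * norm (v z) powr p"
      using powr_add_convex[OF assms(1) norm_ge_zero norm_ge_zero AB, of "u z" "v z"]
      by (simp add: \<alpha>_def \<beta>_def distrib_left)
    finally show ?thesis .
  qed
  then have "ennreal (norm (u z + v z) powr p) \<le> \<alpha> * ennreal (norm (u z) powr p) + \<beta> * ennreal (norm (v z) powr p)" for z
    using nn by (simp flip: ennreal_mult ennreal_plus add: ennreal_leI)
  then have "Lp_mass p {a..b} x (\<lambda>z. u z + v z) \<le>
    (\<integral>\<^sup>+t. \<alpha> * (ennreal (norm (u (t, x t)) powr p) * indicator {a..b} t) +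
          \<beta> * (ennreal (norm (v (t, x t)) powr p) * indicator {a..b} t) \<partial>lebesgue)"
    unfolding Lp_mass_def by (intro nn_integral_mono) (auto simp: indicator_def)
  also have "\<dots> = \<alpha> * Lp_mass p {a..b} x u + \<beta> * Lp_mass p {a..b} x v"
    unfolding Lp_mass_def
    using borel_measurable_along_ennreal[OF u x, of p] borel_measurable_along_ennreal[OF v x, of p]
    by (subst nn_integral_add) (auto intro!: borel_measurable_times simp: nn_integral_cmult)
  also have "\<dots> \<le> \<alpha> * ennreal (A powr p) + \<beta> * ennreal (B powr p)"
    by (intro add_mono mult_left_mono assms) auto
  also have "\<dots> = ennreal (\<alpha> * A powr p + \<beta> * B powr p)"
    using nn by (simp add: ennreal_mult)
  also have "\<alpha> * A powr p + \<beta> * B powr p = (A + B) powr p * (A / (A + B)) + (A + B) powr p * (B / (A + B))"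
    using AB by (simp add: \<alpha>_def \<beta>_def)
  also have "\<dots> = (A + B) powr p * ((A + B) / (A + B))"
    by (simp only: distrib_left add_divide_distrib)
  also have "\<dots> = (A + B) powr p" using AB by simp
  finally show ?thesis .
qed

text \<open>
  Minkowski's inequality. The bounds \<open>A\<close> and \<open>B\<close> above must be positive, so the two norms are
  enlarged by \<open>e / 2\<close>, which also covers norms that vanish.
\<close>

lemma Lp_along_add_le:
  fixes u v :: "real \<times> (real^'n) \<Rightarrow> real^'m"
  assumes p: "1 \<le> p" and u: "u \<in> SC p" and v: "v \<in> SC p" and x: "x \<in> C_ball {a..b} j"
  shows "Lp_along p {a..b} x (\<lambda>z. u z + v z) \<le> Lp_along p {a..b} x u + Lp_along p {a..b} x v"
proof (rule field_le_epsilon)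
  fix e :: real assume e: "e > 0"
  have uv: "(\<lambda>z. u z + v z) \<in> SC p"
    using SC_lincomb[OF p u v, of 1] by simp
  have cont: "continuous_on {a..b} x" using x by (simp add: C_ball_def)
  have fin: "Lp_mass p {a..b} x f < \<infinity>" and meas: "f \<in> borel_measurable borel" if "f \<in> SC p" for f :: "real \<times> (real^'n) \<Rightarrow> real^'m"
    using SC_imp_Lp_mass_bounded[OF _ that, of a b j] p x that
    by (auto simp: SC_def intro: le_less_trans)
  have nn: "0 \<le> Lp_along p {a..b} x f" for f :: "real \<times> (real^'n) \<Rightarrow> real^'m"
    by (simp add: Lp_along_def)
  have le: "Lp_mass p {a..b} x f \<le> ennreal ((Lp_along p {a..b} x f + e / 2) powr p)" if "f \<in> SC p" for f :: "real \<times> (real^'n) \<Rightarrow> real^'m"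
    using Lp_along_le_iff[OF meas[OF that] cont _ fin[OF that], of "Lp_along p {a..b} x f + e / 2"] p e nn[of f]
    by auto
  have "Lp_mass p {a..b} x (\<lambda>z. u z + v z) \<le>
      ennreal (((Lp_along p {a..b} x u + e / 2) + (Lp_along p {a..b} x v + e / 2)) powr p)"
    by (rule Lp_mass_add_le[OF p meas[OF u] meas[OF v] cont _ _ le[OF u] le[OF v]])
      (use e nn[of u] nn[of v] in auto)
  then have "Lp_along p {a..b} x (\<lambda>z. u z + v z) \<le>
     (Lp_along p {a..b} x u + e / 2) + (Lp_along p {a..b} x v + e / 2)"
    using p e nn[of u] nn[of v] by (subst Lp_along_le_iff[OF meas[OF uv] cont _ fin[OF uv]]) auto
  then show "Lp_along p {a..b} x (\<lambda>z. u z + v z) \<le> Lp_along p {a..b} x u + Lp_along p {a..b} x v + e"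
    by simp
qed

lemma bdd_above_Lp_along:
  fixes f :: "real \<times> (real^'n) \<Rightarrow> real^'m"
  assumes "1 \<le> p" "f \<in> SC p" "X \<subseteq> C_ball {a..b} j"
  shows "bdd_above ((\<lambda>x. Lp_along p {a..b} x f) ` X)"
proof -
  obtain B where B: "B \<ge> 0" "\<forall>x\<in>C_ball {a..b} j. Lp_mass p {a..b} x f \<le> ennreal (B powr p)"
    using SC_imp_Lp_mass_bounded[of p f a b j] assms by auto
  show ?thesis
  proof (rule bdd_aboveI2)
    fix x assume "x \<in> X"
    then have x: "continuous_on {a..b} x" "Lp_mass p {a..b} x f \<le> ennreal (B powr p)"
      using assms B by (auto simp: C_ball_def)
    moreover from x(2) have "Lp_mass p {a..b} x f < \<infinity>"
      by (rule le_less_trans) simp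
    ultimately show "Lp_along p {a..b} x f \<le> B"
      using assms B by (subst Lp_along_le_iff) (auto simp: SC_def)
  qed
qed

text \<open>
  This covers all three families: \<open>X\<close> consists of all continuous paths in a ball, of those with a given
  modulus of continuity, or of a single constant path.
\<close>

lemma SC_seminorm_SUP:
  assumes p: "1 \<le> p" and X: "X \<subseteq> C_ball {a..b} j" "X \<noteq> {}"
  shows "SC_seminorm p (\<lambda>f :: real \<times> (real^'n) \<Rightarrow> real^'m. SUP x\<in>X. Lp_along p {a..b} x f)"
  unfolding SC_seminorm_def
proof (intro conjI ballI)
  have "Lp_along p {a..b} x (\<lambda>z. 0 :: real^'m) = 0" for x :: "real \<Rightarrow> real^'n"
    by (simp add: Lp_along_def set_lebesgue_integral_def)
  then show "(SUP x\<in>X. Lp_along p {a..b} x (\<lambda>z. 0 :: real^'m)) = 0"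
    using X(2) by simp
next
  fix u v :: "real \<times> (real^'n) \<Rightarrow> real^'m" assume uv: "u \<in> SC p" "v \<in> SC p"
  show "(SUP x\<in>X. Lp_along p {a..b} x (\<lambda>z. u z + v z)) \<le>
      (SUP x\<in>X. Lp_along p {a..b} x u) + (SUP x\<in>X. Lp_along p {a..b} x v)"
  proof (rule cSUP_least[OF X(2)])
    fix x assume x: "x \<in> X"
    have "Lp_along p {a..b} x (\<lambda>z. u z + v z) \<le> Lp_along p {a..b} x u + Lp_along p {a..b} x v"
      using x X by (intro Lp_along_add_le[OF p uv]) auto
    also have "\<dots> \<le> (SUP x\<in>X. Lp_along p {a..b} x u) + (SUP x\<in>X. Lp_along p {a..b} x v)"
      using x by (intro add_mono cSUP_upper bdd_above_Lp_along[OF p _ X(1)] uv)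
    finally show "Lp_along p {a..b} x (\<lambda>z. u z + v z) \<le> \<dots>" .
  qed
qed

section \<open>Local oscillation in the space variable\<close>

text \<open>
  The \<open>p\<close>-th power of the oscillation of \<open>f (t, \<cdot>)\<close> at scale \<open>\<delta>\<close> inside the ball of radius \<open>R\<close>. The
  points are taken from \<open>D\<close>, which is meant to be countable and dense: then the supremum is
  measurable in \<open>t\<close>, and for continuous \<open>f (t, \<cdot>)\<close> it bounds the oscillation over all points.
\<close>

definition pointwise_osc ::
  "(real^'n) set \<Rightarrow> real \<Rightarrow> real \<Rightarrow> real \<Rightarrow> (real \<times> (real^'n) \<Rightarrow> real^'m) \<Rightarrow> real \<Rightarrow> ennreal" where
  "pointwise_osc D R \<delta> p f t =
     (SUP (x, y)\<in>{(x, y). norm x < R \<and> norm y < R \<and> dist x y < \<delta>} \<inter> D \<times> D.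
        ennreal (norm (f (t, x) - f (t, y)) powr p))"

lemma borel_measurable_pointwise_osc:
  fixes f :: "real \<times> (real^'n) \<Rightarrow> real^'m"
  assumes [measurable]: "f \<in> borel_measurable borel" and "countable D"
  shows "pointwise_osc D R \<delta> p f \<in> borel_measurable lebesgue"
proof -
  have "(\<lambda>t. pointwise_osc D R \<delta> p f t) \<in> borel_measurable borel"
    unfolding pointwise_osc_def
  proof (rule borel_measurable_SUP)
    show "countable ({(x, y). norm x < R \<and> norm y < R \<and> dist x y < \<delta>} \<inter> D \<times> D)"
      using assms(2) by (auto intro: countable_Int2)
    show "(\<lambda>t. case i of (x, y) \<Rightarrow> ennreal (norm (f (t, x) - f (t, y)) powr p)) \<in> borel_measurable borel" for i
      by (cases i) simp
  qed
  then show ?thesis by (rule borel_measurable_lebesgueI)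
qed

lemma borel_measurable_pointwise_osc_indicator:
  fixes f :: "real \<times> (real^'n) \<Rightarrow> real^'m"
  assumes "f \<in> borel_measurable borel" "countable D"
  shows "(\<lambda>t. pointwise_osc D R \<delta> p f t * indicator {a..b} t) \<in> borel_measurable lebesgue"
  by (intro borel_measurable_times_ennreal borel_measurable_pointwise_osc assms borel_measurable_indicator) auto

text \<open>
  The pairs of points at distance below \<open>\<delta>\<close> in the open ball form an open set, in which the pairs
  from \<open>D\<close> are dense; the inequality is a closed condition and passes to the closure.
\<close>

lemma le_pointwise_osc:
  fixes f :: "real \<times> (real^'n) \<Rightarrow> real^'m"
  assumes p: "0 < p" and f: "continuous_on UNIV (\<lambda>x. f (t, x))" and D: "closure D = UNIV"
    and xy: "norm x < R" "norm y < R" "dist x y < \<delta>"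
  shows "ennreal (norm (f (t, x) - f (t, y)) powr p) \<le> pointwise_osc D R \<delta> p f t"
proof -
  define S :: "((real^'n) \<times> (real^'n)) set" where "S = {(x, y). norm x < R \<and> norm y < R \<and> dist x y < \<delta>}"
  define \<phi> :: "(real^'n) \<times> (real^'n) \<Rightarrow> ennreal" where "\<phi> z = ennreal (norm (f (t, fst z) - f (t, snd z)) powr p)" for z
  have "open S"
    unfolding S_def case_prod_beta by (intro open_Collect_conj open_Collect_less continuous_intros)
  then have "S \<subseteq> closure (S \<inter> D \<times> D)"
    using open_Int_closure_subset[of S "D \<times> D"] D by (simp add: closure_Times)
  also have "\<dots> \<subseteq> {z. \<phi> z \<le> pointwise_osc D R \<delta> p f t}"
  proof (rule closure_minimal)
    show "S \<inter> D \<times> D \<subseteq> {z. \<phi> z \<le> pointwise_osc D R \<delta> p f t}"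
    proof
      fix z assume "z \<in> S \<inter> D \<times> D"
      then have "(case z of (x, y) \<Rightarrow> ennreal (norm (f (t, x) - f (t, y)) powr p)) \<le> pointwise_osc D R \<delta> p f t"
        unfolding pointwise_osc_def S_def by (rule SUP_upper)
      then show "z \<in> {z. \<phi> z \<le> pointwise_osc D R \<delta> p f t}"
        by (simp add: \<phi>_def case_prod_beta)
    qed
    have "continuous_on UNIV \<phi>"
      unfolding \<phi>_def using p
      by (intro continuous_on_ennreal continuous_on_powr' continuous_intros
          continuous_on_compose2[OF f]) auto
    then show "closed {z. \<phi> z \<le> pointwise_osc D R \<delta> p f t}"
      by (intro closed_Collect_le continuous_on_const)
  qed
  finally show ?thesis
    using xy by (auto simp: S_def \<phi>_def)
qed

lemma pointwise_osc_leI: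
  assumes "\<And>x y. norm x < R \<Longrightarrow> norm y < R \<Longrightarrow> dist x y < \<delta> \<Longrightarrow> norm (f (t, x) - f (t, y)) powr p \<le> c"
  shows "pointwise_osc D R \<delta> p f t \<le> ennreal c"
  unfolding pointwise_osc_def by (intro SUP_least) (auto intro!: ennreal_leI assms)

lemma pointwise_osc_le_l_bound:
  fixes g :: "real \<times> (real^'n) \<Rightarrow> real^'m"
  assumes p: "0 < p" and lip: "\<forall>x\<in>cball 0 (real j). \<forall>y\<in>cball 0 (real j). norm (g (t, x) - g (t, y)) \<le> l * norm (x - y)"
  shows "pointwise_osc D (real j) \<delta> p g t \<le> ennreal (\<delta> powr p * l_bound j g t powr p)"
proof (rule pointwise_osc_leI)
  fix x y :: "real^'n" assume xy: "norm x < real j" "norm y < real j" "dist x y < \<delta>"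
  show "norm (g (t, x) - g (t, y)) powr p \<le> \<delta> powr p * l_bound j g t powr p"
  proof (cases "x = y")
    case False
    have \<delta>: "0 \<le> \<delta>" using xy(3) zero_le_dist[of x y] by linarith
    let ?q = "norm (g (t, x) - g (t, y)) / norm (x - y)"
    have q: "?q \<le> l_bound j g t"
      unfolding l_bound_def
    proof (rule cSup_upper)
      show "bdd_above {norm (g (t, x) - g (t, y)) / norm (x - y) | x y.
          x \<in> cball 0 (real j) \<and> y \<in> cball 0 (real j) \<and> x \<noteq> y}"
        using lip by (intro bdd_aboveI[of _ l]) (auto simp: field_simps)
    qed (use xy False in force)
    have l0: "0 \<le> l_bound j g t"
      by (rule order_trans[OF _ q]) simp
    have "norm (g (t, x) - g (t, y)) = norm (x - y) * ?q" using False by simp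
    also have "\<dots> \<le> \<delta> * l_bound j g t"
      using q xy(3) \<delta> by (intro mult_mono) (auto simp: dist_norm)
    finally have "norm (g (t, x) - g (t, y)) powr p \<le> (\<delta> * l_bound j g t) powr p"
      using p by (intro powr_mono2) auto
    then show ?thesis using l0 \<delta> by (simp add: powr_mult)
  qed simp
qed

lemma pointwise_osc_tendsto_0:
  fixes f :: "real \<times> (real^'n) \<Rightarrow> real^'m"
  assumes p: "0 < p" and f: "continuous_on UNIV (\<lambda>x. f (t, x))"
  shows "(\<lambda>n. pointwise_osc D R (inverse (real (Suc n))) p f t) \<longlonglongrightarrow> 0"
proof (rule order_tendstoI)
  fix e :: ennreal assume "0 < e"
  then obtain e0 where e0: "0 < e0" "e0 < e" using dense by blast
  then obtain c where c: "e0 = ennreal c" "c > 0"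
    by (cases e0) (auto simp: ennreal_less_zero_iff)
  have "uniformly_continuous_on (cball 0 R) (\<lambda>x. f (t, x))"
    using f by (intro compact_uniformly_continuous) (auto intro: continuous_on_subset)
  moreover have "0 < c powr (1 / p)" using c by simp
  ultimately obtain d where d: "d > 0"
    "\<And>x y. x \<in> cball 0 R \<Longrightarrow> y \<in> cball 0 R \<Longrightarrow> dist y x < d \<Longrightarrow> dist (f (t, y)) (f (t, x)) < c powr (1 / p)"
    unfolding uniformly_continuous_on_def by metis
  have "eventually (\<lambda>n. inverse (real (Suc n)) < d) sequentially"
    by (rule order_tendstoD(2)[OF LIMSEQ_inverse_real_of_nat d(1)])
  then show "eventually (\<lambda>n. pointwise_osc D R (inverse (real (Suc n))) p f t < e) sequentially"
  proof eventually_elim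
    case (elim n)
    have "pointwise_osc D R (inverse (real (Suc n))) p f t \<le> ennreal c"
    proof (rule pointwise_osc_leI)
      fix x y :: "real^'n" assume "norm x < R" "norm y < R" "dist x y < inverse (real (Suc n))"
      then have "norm (f (t, x) - f (t, y)) \<le> c powr (1 / p)"
        using d(2)[of y x] elim by (auto simp: dist_norm intro: less_imp_le)
      then have "norm (f (t, x) - f (t, y)) powr p \<le> (c powr (1 / p)) powr p"
        using p by (intro powr_mono2) auto
      then show "norm (f (t, x) - f (t, y)) powr p \<le> c" using p c by (simp add: powr_powr)
    qed
    then show ?case using e0 c by simp
  qed
qed auto

text \<open>
  A general Caratheodory function need not have a Lipschitz bound, but for almost every \<open>t\<close> it is uniformly
  continuous on compact balls. Its oscillation thus tends to 0 pointwise, and it is dominated by twice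
  the bound on the ball.
\<close>

lemma integral_pointwise_osc_tendsto_0:
  fixes f :: "real \<times> (real^'n) \<Rightarrow> real^'m"
  assumes p: "1 \<le> p" and f: "f \<in> SC p" and D: "countable D"
  shows "(\<lambda>n. \<integral>\<^sup>+t\<in>{a..b}. pointwise_osc D R (inverse (real (Suc n))) p f t \<partial>lebesgue) \<longlonglongrightarrow> 0"
proof -
  obtain m where m: "m \<in> Lploc p" "AE t in lebesgue. \<forall>x\<in>cball 0 R. norm (f (t, x)) \<le> m t"
    by (rule SC_bounded[OF f compact_cball])
  have m2: "(\<lambda>t. m t + m t) \<in> Lploc p"
    by (rule Lploc_add[OF p m(1) m(1)])
  have cont: "AE t in lebesgue. continuous_on UNIV (\<lambda>x. f (t, x))" using f by (simp add: SC_def)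
  have "(\<lambda>n. \<integral>\<^sup>+t. pointwise_osc D R (inverse (real (Suc n))) p f t * indicator {a..b} t \<partial>lebesgue)
      \<longlonglongrightarrow> (\<integral>\<^sup>+(t::real). 0 \<partial>lebesgue)"
  proof (rule nn_integral_dominated_convergence[where w = "\<lambda>t. ennreal (\<bar>m t + m t\<bar> powr p) * indicator {a..b} t"])
    show "(\<lambda>t. ennreal (\<bar>m t + m t\<bar> powr p) * indicator {a..b} t) \<in> borel_measurable lebesgue"
      and "(\<integral>\<^sup>+t. ennreal (\<bar>m t + m t\<bar> powr p) * indicator {a..b} t \<partial>lebesgue) < \<infinity>"
      by (rule Lploc_nn_integral[OF m2])+
    show "AE t in lebesgue. pointwise_osc D R (inverse (real (Suc n))) p f t * indicator {a..b} t
        \<le> ennreal (\<bar>m t + m t\<bar> powr p) * indicator {a..b} t" for n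
      using m(2)
    proof eventually_elim
      case (elim t)
      have "pointwise_osc D R (inverse (real (Suc n))) p f t \<le> ennreal (\<bar>m t + m t\<bar> powr p)"
      proof (rule pointwise_osc_leI)
        fix x y :: "real^'n" assume "norm x < R" "norm y < R"
        then have "norm (f (t, x)) \<le> m t" "norm (f (t, y)) \<le> m t" using elim by auto
        then have "norm (f (t, x) - f (t, y)) \<le> \<bar>m t + m t\<bar>"
          using norm_triangle_ineq4[of "f (t, x)" "f (t, y)"] by linarith
        then show "norm (f (t, x) - f (t, y)) powr p \<le> \<bar>m t + m t\<bar> powr p"
          using p by (intro powr_mono2) auto
      qed
      then show ?case by (rule mult_right_mono) simp
    qed
    show "AE t in lebesgue. (\<lambda>n. pointwise_osc D R (inverse (real (Suc n))) p f t * indicator {a..b} t) \<longlonglongrightarrow> 0"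
      using cont
    proof eventually_elim
      case (elim t)
      from pointwise_osc_tendsto_0[OF _ elim, of p D R] p show ?case
        by (cases "t \<in> {a..b}") auto
    qed
  qed (auto intro: borel_measurable_pointwise_osc_indicator[OF SC_measurable[OF f] D])
  then show ?thesis by simp
qed

text \<open>
  For the members of \<open>E\<close> the oscillation at scale \<open>\<delta>\<close> is at most \<open>\<delta>\<close> times the l-bound. This is where
  the hypothesis on \<open>E\<close> enters: it makes the estimate uniform in \<open>G\<close>.
\<close>

lemma bounded_l_bounds_osc:
  fixes E :: "(real \<times> (real^'n) \<Rightarrow> real^'m) set set"
  assumes p: "1 \<le> p" and E: "E \<subseteq> LC_space p" "Lploc_bounded_l_bounds p E" and D: "countable D"
  shows "\<exists>C\<ge>0. \<forall>G\<in>E. \<forall>\<delta>>0. (\<integral>\<^sup>+t\<in>{a..b}. pointwise_osc D (real (Suc j)) \<delta> p (rep G) t \<partial>lebesgue) \<le> ennreal (\<delta> powr p * C)"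
proof -
  define r where "r = \<bar>a\<bar> + \<bar>b\<bar> + 1"
  have r: "r > 0" "{a..b} \<subseteq> {-r..r}" by (auto simp: r_def)
  have "(SUP F\<in>E. \<integral>\<^sup>+t\<in>{-r..r}. ennreal (l_bound (Suc j) (rep F) t powr p) \<partial>lebesgue) < \<infinity>"
    using E(2) r(1) by (auto simp: Lploc_bounded_l_bounds_def)
  then obtain C where C: "C \<ge> 0"
    "(SUP F\<in>E. \<integral>\<^sup>+t\<in>{-r..r}. ennreal (l_bound (Suc j) (rep F) t powr p) \<partial>lebesgue) = ennreal C"
    unfolding infinity_ennreal_def less_top_ennreal by (elim exE conjE)
  have "(\<integral>\<^sup>+t\<in>{a..b}. pointwise_osc D (real (Suc j)) \<delta> p (rep G) t \<partial>lebesgue) \<le> ennreal (\<delta> powr p * C)"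
    if G: "G \<in> E" and \<delta>: "\<delta> > 0" for G \<delta>
  proof -
    obtain g where g: "g \<in> G" "g \<in> LC p" "G \<in> SC_space p"
    proof -
      have "G \<in> LC_space p" using G E(1) by (rule rev_subsetD)
      then show thesis using that unfolding LC_space_def by auto
    qed
    have eq: "AE t in lebesgue. \<forall>x. rep G (t, x) = g (t, x)"
      by (rule ae_rel_imp_AE_all[OF rep_ae_rel[OF g(3,1)]])
    obtain l where l: "AE t in lebesgue. \<forall>x\<in>cball 0 (real (Suc j)). \<forall>y\<in>cball 0 (real (Suc j)).
         norm (g (t, x) - g (t, y)) \<le> l t * norm (x - y)"
    proof -
      have "\<exists>l\<in>Lploc p. AE t in lebesgue. \<forall>x\<in>cball 0 (real (Suc j)). \<forall>y\<in>cball 0 (real (Suc j)).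
         norm (g (t, x) - g (t, y)) \<le> l t * norm (x - y)"
        using g(2) by (simp add: LC_def del: of_nat_Suc)
      then show thesis using that by (elim bexE)
    qed
    have ae: "AE t in lebesgue. pointwise_osc D (real (Suc j)) \<delta> p (rep G) t \<le>
       ennreal (\<delta> powr p) * ennreal (l_bound (Suc j) (rep G) t powr p)"
      using eq l
    proof eventually_elim
      case (elim t)
      then show ?case
        using pointwise_osc_le_l_bound[of p "Suc j" "rep G" t "l t" D \<delta>] p by (simp add: ennreal_mult)
    qed
    let ?c = "inverse (\<delta> powr p)"
    have c: "\<delta> powr p > 0" using \<delta> by simp
    have mo: "(\<lambda>t. pointwise_osc D (real (Suc j)) \<delta> p (rep G) t * indicator {a..b} t) \<in> borel_measurable lebesgue"
      by (rule borel_measurable_pointwise_osc_indicator[OF SC_measurable[OF rep_in_SC[OF g(3)]] D])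
    \<comment> \<open>The constant is put next to the oscillation, whose measurability allows it to be pulled out
      of the integral.\<close>
    have "ennreal ?c * (\<integral>\<^sup>+t\<in>{a..b}. pointwise_osc D (real (Suc j)) \<delta> p (rep G) t \<partial>lebesgue) =
      (\<integral>\<^sup>+t. ennreal ?c * (pointwise_osc D (real (Suc j)) \<delta> p (rep G) t * indicator {a..b} t) \<partial>lebesgue)"
      using mo by (simp add: nn_integral_cmult)
    also have "\<dots> \<le> (\<integral>\<^sup>+t\<in>{-r..r}. ennreal (l_bound (Suc j) (rep G) t powr p) \<partial>lebesgue)"
    proof (rule nn_integral_mono_AE)
      show "AE t in lebesgue. ennreal ?c * (pointwise_osc D (real (Suc j)) \<delta> p (rep G) t * indicator {a..b} t)
         \<le> ennreal (l_bound (Suc j) (rep G) t powr p) * indicator {-r..r} t"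
        using ae
      proof eventually_elim
        case (elim t)
        have "ennreal ?c * pointwise_osc D (real (Suc j)) \<delta> p (rep G) t \<le>
            ennreal ?c * (ennreal (\<delta> powr p) * ennreal (l_bound (Suc j) (rep G) t powr p))"
          by (intro mult_left_mono elim) simp
        also have "\<dots> = ennreal (?c * \<delta> powr p) * ennreal (l_bound (Suc j) (rep G) t powr p)"
          using c by (simp only: ennreal_mult mult.assoc inverse_nonnegative_iff_nonnegative less_imp_le)
        also have "\<dots> = ennreal (l_bound (Suc j) (rep G) t powr p)"
          using c by simp
        finally show ?case
          using r(2) by (auto simp: indicator_def)
      qed
    qed
    also have "\<dots> \<le> ennreal C"
      unfolding C(2)[symmetric] using G by (rule SUP_upper)
    finally have "ennreal (\<delta> powr p) * (ennreal ?c * (\<integral>\<^sup>+t\<in>{a..b}. pointwise_osc D (real (Suc j)) \<delta> p (rep G) t \<partial>lebesgue))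
        \<le> ennreal (\<delta> powr p) * ennreal C"
      by (rule mult_left_mono) simp
    moreover have "ennreal (\<delta> powr p) * (ennreal ?c * I) = I" for I
      using c by (simp add: mult.assoc[symmetric] ennreal_mult[symmetric])
    ultimately show ?thesis
      using C(1) by (simp add: ennreal_mult)
  qed
  then show ?thesis using C(1) by blast
qed

text \<open>
  If \<open>d\<close> is a net point within \<open>\<delta>\<close> of \<open>x t\<close>, then \<open>g - f\<close> at \<open>x t\<close> differs from \<open>g - f\<close> at \<open>d\<close> by at
  most the two oscillations. As \<open>d\<close> depends on \<open>t\<close>, the sum over the whole net is taken. Net points may lie
  slightly outside the ball of radius \<open>j\<close>, hence the radius \<open>Suc j\<close>. The right-hand side does not
  depend on the path.
\<close>

lemma Lp_mass_diff_le_osc: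
  fixes f g :: "real \<times> (real^'n) \<Rightarrow> real^'m"
  assumes p: "1 \<le> p" and f: "f \<in> SC p" and g: "g \<in> SC p" and D: "countable D" "closure D = UNIV"
    and net: "finite N" "N \<subseteq> D" "cball 0 (real j) \<subseteq> (\<Union>d\<in>N. ball d \<delta>)" and \<delta>: "\<delta> \<le> 1"
    and x: "x \<in> C_ball {a..b} j"
  shows "Lp_mass p {a..b} x (\<lambda>z. g z - f z) \<le> ennreal (3 powr p) *
    ((\<integral>\<^sup>+t\<in>{a..b}. pointwise_osc D (real (Suc j)) \<delta> p g t \<partial>lebesgue) +
     (\<Sum>d\<in>N. Lp_mass p {a..b} (\<lambda>_. d) (\<lambda>z. g z - f z)) +
     (\<integral>\<^sup>+t\<in>{a..b}. pointwise_osc D (real (Suc j)) \<delta> p f t \<partial>lebesgue))"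
proof -
  have mf: "f \<in> borel_measurable borel" and mg: "g \<in> borel_measurable borel"
    using f g by (auto simp: SC_def)
  have mh: "(\<lambda>z. g z - f z) \<in> borel_measurable borel"
    using mf mg by (rule borel_measurable_diff[rotated])
  note mo = borel_measurable_pointwise_osc_indicator[OF mf D(1)] borel_measurable_pointwise_osc_indicator[OF mg D(1)]
  have cont: "AE t in lebesgue. continuous_on UNIV (\<lambda>x. f (t, x))" "AE t in lebesgue. continuous_on UNIV (\<lambda>x. g (t, x))"
    using f g by (auto simp: SC_def)
  have "Lp_mass p {a..b} x (\<lambda>z. g z - f z) \<le>
    (\<integral>\<^sup>+t. ennreal (3 powr p) * (pointwise_osc D (real (Suc j)) \<delta> p g t * indicator {a..b} t +
      (\<Sum>d\<in>N. ennreal (norm (g (t, d) - f (t, d)) powr p) * indicator {a..b} t) +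
      pointwise_osc D (real (Suc j)) \<delta> p f t * indicator {a..b} t) \<partial>lebesgue)"
    unfolding Lp_mass_def
  proof (rule nn_integral_mono_AE)
    show "AE t in lebesgue. ennreal (norm (g (t, x t) - f (t, x t)) powr p) * indicator {a..b} t \<le>
      ennreal (3 powr p) * (pointwise_osc D (real (Suc j)) \<delta> p g t * indicator {a..b} t +
      (\<Sum>d\<in>N. ennreal (norm (g (t, d) - f (t, d)) powr p) * indicator {a..b} t) +
      pointwise_osc D (real (Suc j)) \<delta> p f t * indicator {a..b} t)"
      using cont
    proof eventually_elim
      case (elim t)
      show ?case
      proof (cases "t \<in> {a..b}")
        case True
        then have "x t \<in> cball 0 (real j)" using x unfolding C_ball_def by blast
        then have xt: "norm (x t) \<le> real j" by simp
        then obtain d where d: "d \<in> N" "dist d (x t) < \<delta>" using net(3) by force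
        have nd: "norm d < real (Suc j)" "norm (x t) < real (Suc j)"
          using norm_triangle_sub[of d "x t"] d(2) \<delta> xt by (auto simp: dist_norm)
        let ?A = "norm (g (t, x t) - g (t, d))" and ?B = "norm (g (t, d) - f (t, d))"
          and ?C = "norm (f (t, d) - f (t, x t))"
        have "norm (g (t, x t) - f (t, x t)) \<le> ?A + ?B + ?C"
          using norm_triangle_ineq[of "g (t, x t) - g (t, d)" "g (t, d) - f (t, d)"]
            norm_triangle_ineq[of "g (t, x t) - f (t, d)" "f (t, d) - f (t, x t)"] by simp
        then have "norm (g (t, x t) - f (t, x t)) powr p \<le> (?A + ?B + ?C) powr p"
          using p by (intro powr_mono2) auto
        also have "\<dots> \<le> 3 powr p * (?A powr p + ?B powr p + ?C powr p)"
          using p by (intro powr_add3_le) auto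
        finally have "ennreal (norm (g (t, x t) - f (t, x t)) powr p) \<le>
          ennreal (3 powr p) * (ennreal (?A powr p) + ennreal (?B powr p) + ennreal (?C powr p))"
          by (simp flip: ennreal_mult ennreal_plus add: ennreal_leI)
        also have "\<dots> \<le> ennreal (3 powr p) * (pointwise_osc D (real (Suc j)) \<delta> p g t +
            (\<Sum>d\<in>N. ennreal (norm (g (t, d) - f (t, d)) powr p)) + pointwise_osc D (real (Suc j)) \<delta> p f t)"
        proof (intro mult_left_mono add_mono)
          show "ennreal (?A powr p) \<le> pointwise_osc D (real (Suc j)) \<delta> p g t"
            using p nd d by (intro le_pointwise_osc elim D) (auto simp: dist_commute)
          show "ennreal (?C powr p) \<le> pointwise_osc D (real (Suc j)) \<delta> p f t"
            using p nd d by (intro le_pointwise_osc elim D) (auto simp: dist_commute)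
          show "ennreal (?B powr p) \<le> (\<Sum>d\<in>N. ennreal (norm (g (t, d) - f (t, d)) powr p))"
            by (rule member_le_sum[OF d(1)]) (use net(1) in auto)
        qed simp
        finally show ?thesis using True by simp
      qed simp
    qed
  qed
  also have "\<dots> = ennreal (3 powr p) *
    ((\<integral>\<^sup>+t\<in>{a..b}. pointwise_osc D (real (Suc j)) \<delta> p g t \<partial>lebesgue) +
     (\<Sum>d\<in>N. Lp_mass p {a..b} (\<lambda>_. d) (\<lambda>z. g z - f z)) +
     (\<integral>\<^sup>+t\<in>{a..b}. pointwise_osc D (real (Suc j)) \<delta> p f t \<partial>lebesgue))"
  proof -
    have "(\<lambda>t. ennreal (norm (g (t, d) - f (t, d)) powr p) * indicator {a..b} t) \<in> borel_measurable lebesgue" for d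
      using borel_measurable_along_ennreal[OF mh, of a b "\<lambda>_. d"] by simp
    moreover note mo
    ultimately show ?thesis
      unfolding Lp_mass_def
      by (simp add: nn_integral_cmult nn_integral_add nn_integral_sum borel_measurable_add borel_measurable_sum
          del: of_nat_Suc)
  qed
  finally show ?thesis .
qed

section \<open>The three families of seminorms\<close>

lemma const_in_C_ball: "norm x \<le> real j \<Longrightarrow> (\<lambda>_. x) \<in> C_ball I j"
  by (auto simp: C_ball_def)

lemma const_in_K_mod:
  assumes "suitable_moduli \<theta>" "I \<in> rat_intervals" "1 \<le> j" "norm x \<le> real j"
  shows "(\<lambda>_. x) \<in> K_mod \<theta> I j"
proof -
  have "0 \<le> \<theta> I j \<bar>s - t\<bar>" for s t
    using assms(1-3) abs_ge_zero[of "s - t"] unfolding suitable_moduli_def by (metis atLeast_iff image_subset_iff)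
  then show ?thesis
    using assms by (auto simp: K_mod_def const_in_C_ball)
qed

lemma K_mod_subset_C_ball: "K_mod \<theta> I j \<subseteq> C_ball I j"
  by (auto simp: K_mod_def)

lemma C_ball_nonempty: "C_ball I j \<noteq> {}"
  using const_in_C_ball[of 0 j I] by auto

lemma K_mod_nonempty:
  "suitable_moduli \<theta> \<Longrightarrow> I \<in> rat_intervals \<Longrightarrow> 1 \<le> j \<Longrightarrow> K_mod \<theta> I j \<noteq> {}"
  using const_in_K_mod[of \<theta> I j 0] by auto

lemma rat_intervalsE:
  assumes "I \<in> rat_intervals"
  obtains a b where "I = {a..b}"
  using assms by (auto simp: rat_intervals_def)

lemma exists_nat_norm_le: "\<exists>j\<ge>1. norm x \<le> real j"
proof -
  obtain k where "norm x \<le> real k" using real_arch_simple by blast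
  then show ?thesis by (intro exI[of _ "Suc k"]) auto
qed

lemma zero_rat_interval: "{0..0} \<in> rat_intervals"
  unfolding rat_intervals_def using Rats_0 by blast

lemma seminorms_DE:
  assumes "\<rho> \<in> seminorms_D p D"
  obtains a b x j where "{a..b} \<in> rat_intervals" "x \<in> D" "1 \<le> j" "norm x \<le> real j"
    "\<rho> = Lp_along p {a..b} (\<lambda>_. x)"
proof -
  obtain I x where I: "I \<in> rat_intervals" "x \<in> D" "\<rho> = Lp_along p I (\<lambda>_. x)"
    using assms by (auto simp: seminorms_D_def)
  obtain a b where "I = {a..b}" using I(1) by (rule rat_intervalsE)
  moreover obtain j where "j \<ge> 1" "norm x \<le> real j" using exists_nat_norm_le by blast
  ultimately show thesis using that I by blast
qed

lemma seminorms_ThetaE: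
  assumes "\<rho> \<in> seminorms_Theta p \<theta>"
  obtains a b j where "{a..b} \<in> rat_intervals" "1 \<le> j"
    "\<rho> = (\<lambda>f. SUP x\<in>K_mod \<theta> {a..b} j. Lp_along p {a..b} x f)"
proof -
  obtain I j where I: "I \<in> rat_intervals" "1 \<le> j" "\<rho> = (\<lambda>f. SUP x\<in>K_mod \<theta> I j. Lp_along p I x f)"
    using assms by (auto simp: seminorms_Theta_def)
  obtain a b where "I = {a..b}" using I(1) by (rule rat_intervalsE)
  with I show thesis by (intro that) auto
qed

lemma seminorms_BE:
  assumes "\<rho> \<in> seminorms_B p"
  obtains a b j where "{a..b} \<in> rat_intervals" "1 \<le> j"
    "\<rho> = (\<lambda>f. SUP x\<in>C_ball {a..b} j. Lp_along p {a..b} x f)"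
proof -
  obtain I j where I: "I \<in> rat_intervals" "1 \<le> j" "\<rho> = (\<lambda>f. SUP x\<in>C_ball I j. Lp_along p I x f)"
    using assms by (auto simp: seminorms_B_def)
  obtain a b where "I = {a..b}" using I(1) by (rule rat_intervalsE)
  with I show thesis by (intro that) auto
qed

lemma SC_seminorm_seminorms_D:
  assumes "1 \<le> p" "\<rho> \<in> seminorms_D p D"
  shows "SC_seminorm p \<rho>"
  using assms(2)
proof (rule seminorms_DE)
  fix a b x j assume "norm x \<le> real j" "\<rho> = Lp_along p {a..b} (\<lambda>_. x)"
  then show ?thesis
    using SC_seminorm_SUP[OF assms(1), of "{\<lambda>_. x}" a b j] const_in_C_ball[of x j "{a..b}"] by simp
qed

lemma SC_seminorm_seminorms_Theta:
  assumes "1 \<le> p" "suitable_moduli \<theta>" "\<rho> \<in> seminorms_Theta p \<theta>"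
  shows "SC_seminorm p \<rho>"
  using assms(3)
proof (rule seminorms_ThetaE)
  fix a b j assume "{a..b} \<in> rat_intervals" "1 \<le> j"
    "\<rho> = (\<lambda>f. SUP x\<in>K_mod \<theta> {a..b} j. Lp_along p {a..b} x f)"
  then show ?thesis
    using SC_seminorm_SUP[OF assms(1) K_mod_subset_C_ball K_mod_nonempty[OF assms(2)]] by simp
qed

lemma SC_seminorm_seminorms_B:
  assumes "1 \<le> p" "\<rho> \<in> seminorms_B p"
  shows "SC_seminorm p \<rho>"
  using assms(2)
proof (rule seminorms_BE)
  fix a b j assume "\<rho> = (\<lambda>f. SUP x\<in>C_ball {a..b} j. Lp_along p {a..b} x f)"
  then show ?thesis
    using SC_seminorm_SUP[OF assms(1) order_refl C_ball_nonempty] by simp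
qed

text \<open>
  Constant paths admit every modulus of continuity.
\<close>

lemma seminorms_Theta_controls_seminorms_D:
  assumes p: "1 \<le> p" and E: "E \<subseteq> SC_space p" and \<theta>: "suitable_moduli \<theta>"
  shows "controls p E (seminorms_Theta p \<theta>) (seminorms_D p D)"
proof (rule controls_if_dominates[OF p E])
  fix \<sigma> assume "\<sigma> \<in> seminorms_D p D"
  then obtain a b x j where *: "{a..b} \<in> rat_intervals" "1 \<le> j" "norm x \<le> real j"
    "\<sigma> = Lp_along p {a..b} (\<lambda>_. x)"
    by (rule seminorms_DE)
  have "\<forall>f\<in>SC p. \<sigma> f \<le> (SUP y\<in>K_mod \<theta> {a..b} j. Lp_along p {a..b} y f)"
    unfolding *(4)
    by (intro ballI cSUP_upper const_in_K_mod[OF \<theta> *(1-3)]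
        bdd_above_Lp_along[OF p _ K_mod_subset_C_ball])
  then show "\<exists>\<rho>\<in>seminorms_Theta p \<theta>. \<forall>f\<in>SC p. \<sigma> f \<le> \<rho> f"
    using *(1,2) by (auto simp: seminorms_Theta_def)
qed

lemma seminorms_B_controls_seminorms_Theta:
  assumes p: "1 \<le> p" and E: "E \<subseteq> SC_space p" and \<theta>: "suitable_moduli \<theta>"
  shows "controls p E (seminorms_B p) (seminorms_Theta p \<theta>)"
proof (rule controls_if_dominates[OF p E])
  fix \<sigma> assume "\<sigma> \<in> seminorms_Theta p \<theta>"
  then obtain a b j where *: "{a..b} \<in> rat_intervals" "1 \<le> j"
    "\<sigma> = (\<lambda>f. SUP x\<in>K_mod \<theta> {a..b} j. Lp_along p {a..b} x f)"
    by (rule seminorms_ThetaE)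
  have "\<forall>f\<in>SC p. \<sigma> f \<le> (SUP y\<in>C_ball {a..b} j. Lp_along p {a..b} y f)"
    unfolding *(3)
    by (intro ballI cSUP_subset_mono K_mod_nonempty[OF \<theta> *(1,2)] K_mod_subset_C_ball order_refl
        bdd_above_Lp_along[OF p _ order_refl])
  then show "\<exists>\<rho>\<in>seminorms_B p. \<forall>f\<in>SC p. \<sigma> f \<le> \<rho> f"
    using *(1,2) by (auto simp: seminorms_B_def)
qed

lemma suitable_moduli_zero: "suitable_moduli (\<lambda>_ _ _. 0)"
  by (auto simp: suitable_moduli_def mono_on_def)

text \<open>
  The zero moduli are suitable, and with them the intermediate family has only constant paths.
\<close>

lemma seminorms_B_controls_seminorms_D:
  assumes "1 \<le> p" "E \<subseteq> SC_space p"
  shows "controls p E (seminorms_B p) (seminorms_D p D)"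
  by (rule controls_trans[OF seminorms_B_controls_seminorms_Theta[OF assms suitable_moduli_zero]
        seminorms_Theta_controls_seminorms_D[OF assms suitable_moduli_zero]])

text \<open>
  The heart of the matter: convergence at the points of \<open>D\<close> is uniform along all paths. First \<open>\<delta>\<close> is
  chosen such that the oscillations of \<open>F\<close> and of all \<open>G \<in> E\<close> are small; only then are the finitely many
  net points, and with them the seminorms that have to be small, fixed.
\<close>

lemma seminorms_D_controls_seminorms_B:
  fixes E :: "(real \<times> (real^'n) \<Rightarrow> real^'m) set set"
  assumes p: "1 \<le> p" and E: "E \<subseteq> LC_space p" "Lploc_bounded_l_bounds p E"
    and D: "countable D" "closure D = UNIV"
  shows "controls p E (seminorms_D p D) (seminorms_B p)"
  unfolding controls_def
proof (intro ballI allI impI)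
  fix F :: "(real \<times> (real^'n) \<Rightarrow> real^'m) set" and e :: real
    and \<sigma> :: "(real \<times> (real^'n) \<Rightarrow> real^'m) \<Rightarrow> real"
  assume F: "F \<in> SC_space p" and \<sigma>B: "\<sigma> \<in> seminorms_B p" and e: "e > 0"
  from \<sigma>B obtain a b j where ab: "{a..b} \<in> rat_intervals"
    and \<sigma>: "\<sigma> = (\<lambda>f. SUP x\<in>C_ball {a..b} j. Lp_along p {a..b} x f)"
    by (rule seminorms_BE)
  \<comment> \<open>Three terms of size \<open>\<eta>\<close> give \<open>(e / 2) powr p\<close>; the half makes up for the supremum over all paths,
    which only preserves weak inequalities.\<close>
  define \<eta> where "\<eta> = (e / 2) powr p / (3 powr p * 3)"
  have \<eta>: "\<eta> > 0" using e by (simp add: \<eta>_def)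
  let ?osc = "\<lambda>\<delta> h. \<integral>\<^sup>+t\<in>{a..b}. pointwise_osc D (real (Suc j)) \<delta> p h t \<partial>lebesgue"
  obtain C where C: "C \<ge> 0" "\<And>G \<delta>. G \<in> E \<Longrightarrow> \<delta> > 0 \<Longrightarrow> ?osc \<delta> (rep G) \<le> ennreal (\<delta> powr p * C)"
    using bounded_l_bounds_osc[OF p E D(1), where a = a and b = b and j = j] by blast
  have "eventually (\<lambda>n. ?osc (inverse (real (Suc n))) (rep F) < ennreal \<eta>) sequentially"
    by (rule order_tendstoD(2)[OF integral_pointwise_osc_tendsto_0[OF p rep_in_SC[OF F] D(1)]]) (use \<eta> in simp)
  moreover have "eventually (\<lambda>n. inverse (real (Suc n)) powr p * C < \<eta>) sequentially"
  proof -
    have "(\<lambda>n. inverse (real (Suc n)) powr p * C) \<longlonglongrightarrow> 0 powr p * C"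
      using p by (intro tendsto_mult tendsto_powr' LIMSEQ_inverse_real_of_nat tendsto_const) auto
    then show ?thesis by (rule order_tendstoD(2)) (use \<eta> in simp)
  qed
  ultimately have "eventually (\<lambda>n. ?osc (inverse (real (Suc n))) (rep F) < ennreal \<eta> \<and>
      inverse (real (Suc n)) powr p * C < \<eta>) sequentially"
    by (rule eventually_conj)
  then obtain n where n: "?osc (inverse (real (Suc n))) (rep F) < ennreal \<eta>"
      "inverse (real (Suc n)) powr p * C < \<eta>"
    by (auto simp: eventually_sequentially)
  define \<delta> where "\<delta> = inverse (real (Suc n))"
  have \<delta>: "0 < \<delta>" "\<delta> \<le> 1" by (auto simp: \<delta>_def field_simps)
  have "cball 0 (real j) \<subseteq> (\<Union>d\<in>D. ball d \<delta>)"
  proof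
    fix y :: "real^'n"
    have "y \<in> closure D" using D(2) by simp
    then obtain d where "d \<in> D" "dist d y < \<delta>" using \<delta>(1) unfolding closure_approachable by blast
    then show "y \<in> (\<Union>d\<in>D. ball d \<delta>)" by auto
  qed
  then obtain N where N: "N \<subseteq> D" "finite N" "cball 0 (real j) \<subseteq> (\<Union>d\<in>N. ball d \<delta>)"
    using compactE_image[OF compact_cball, of D "\<lambda>d. ball d \<delta>" 0 "real j"] by auto
  have "N \<noteq> {}" using N(3) by auto
  then have card: "card N > 0" using N(2) by (simp add: card_gt_0_iff)
  define \<epsilon> where "\<epsilon> = (\<eta> / card N) powr (1 / p)"
  have \<epsilon>: "\<epsilon> > 0" "\<epsilon> powr p = \<eta> / card N"
    using \<eta> card p by (auto simp: \<epsilon>_def powr_powr)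
  define R where "R = (\<lambda>d f. Lp_along p {a..b} (\<lambda>_. d) (f :: real \<times> (real^'n) \<Rightarrow> real^'m)) ` N"
  have "\<sigma> (\<lambda>z. rep G z - rep F z) < e"
    if G: "G \<in> E" "\<forall>\<rho>\<in>R. \<rho> (\<lambda>z. rep G z - rep F z) < \<epsilon>" for G
  proof -
    have GS: "G \<in> SC_space p" using G(1) E(1) by (auto simp: LC_space_def)
    let ?h = "\<lambda>z. rep G z - rep F z"
    have h: "?h \<in> SC p" using p rep_in_SC[OF GS] rep_in_SC[OF F] by (rule SC_diff)
    then have mh: "?h \<in> borel_measurable borel" by (simp add: SC_def)
    have fin: "Lp_mass p {a..b} x ?h < \<infinity>" if "x \<in> C_ball {a..b} k" for x k
      using SC_imp_Lp_mass_bounded[OF _ h, of a b k] p that by (auto intro: le_less_trans)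
    have mass_d: "Lp_mass p {a..b} (\<lambda>_. d) ?h \<le> ennreal (\<eta> / card N)" if "d \<in> N" for d
    proof -
      obtain k where "norm d \<le> real k" using real_arch_simple by blast
      then have "Lp_mass p {a..b} (\<lambda>_. d) ?h < \<infinity>"
        using fin const_in_C_ball by blast
      moreover have "Lp_along p {a..b} (\<lambda>_. d) ?h \<le> \<epsilon>"
        using G(2) that by (auto simp: R_def intro: less_imp_le)
      ultimately show ?thesis
        using Lp_along_le_iff[OF mh, of a b "\<lambda>_. d" p \<epsilon>] \<epsilon> p by auto
    qed
    have "(SUP x\<in>C_ball {a..b} j. Lp_along p {a..b} x ?h) \<le> e / 2"
    proof (rule cSUP_least[OF C_ball_nonempty])
      fix x :: "real \<Rightarrow> real^'n" assume x: "x \<in> C_ball {a..b} j"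
      have "Lp_mass p {a..b} x ?h \<le> ennreal (3 powr p) *
         (?osc \<delta> (rep G) + (\<Sum>d\<in>N. Lp_mass p {a..b} (\<lambda>_. d) ?h) + ?osc \<delta> (rep F))"
        by (rule Lp_mass_diff_le_osc[OF p rep_in_SC[OF F] rep_in_SC[OF GS] D N(2,1,3) \<delta>(2) x])
      also have "\<dots> \<le> ennreal (3 powr p) * (ennreal \<eta> + ennreal \<eta> + ennreal \<eta>)"
      proof (intro mult_left_mono add_mono)
        show "?osc \<delta> (rep G) \<le> ennreal \<eta>"
          using C(2)[OF G(1) \<delta>(1)]
          by (rule order_trans) (use n(2) in \<open>simp add: \<delta>_def ennreal_leI\<close>)
        show "?osc \<delta> (rep F) \<le> ennreal \<eta>"
          using n(1) by (simp add: \<delta>_def)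
        have "(\<Sum>d\<in>N. Lp_mass p {a..b} (\<lambda>_. d) ?h) \<le> (\<Sum>d\<in>N. ennreal (\<eta> / card N))"
          by (intro sum_mono mass_d)
        also have "\<dots> = ennreal \<eta>"
          using \<eta> card by (simp add: ennreal_of_nat_eq_real_of_nat flip: ennreal_mult)
        finally show "(\<Sum>d\<in>N. Lp_mass p {a..b} (\<lambda>_. d) ?h) \<le> ennreal \<eta>" .
      qed simp
      also have "\<dots> = ennreal ((e / 2) powr p)"
        using \<eta> by (simp add: \<eta>_def flip: ennreal_mult ennreal_plus)
      finally show "Lp_along p {a..b} x ?h \<le> e / 2"
        using x p e fin[OF x] by (subst Lp_along_le_iff[OF mh]) (auto simp: C_ball_def)
    qed
    then show ?thesis using e by (simp add: \<sigma>)
  qed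
  moreover have "finite R" "R \<subseteq> seminorms_D p D"
    using N(1,2) ab by (auto simp: R_def seminorms_D_def)
  ultimately show "\<exists>R d. finite R \<and> R \<subseteq> seminorms_D p D \<and> d > 0 \<and>
     (\<forall>G\<in>E. (\<forall>\<rho>\<in>R. \<rho> (\<lambda>z. rep G z - rep F z) < d) \<longrightarrow> \<sigma> (\<lambda>z. rep G z - rep F z) < e)"
    using \<epsilon>(1) by blast
qed

text \<open>
  Each topology comes from a family that lies between the seminorms at the points of some dense set
  and the suprema over all continuous paths. For \<open>T_Theta\<close> and \<open>T_B\<close> any countable dense set will do.
\<close>

lemma admissible_family:
  fixes T :: "(real \<times> (real^'n) \<Rightarrow> real^'m) set topology"
    and E :: "(real \<times> (real^'n) \<Rightarrow> real^'m) set set"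
  assumes p: "1 \<le> p" and E: "E \<subseteq> SC_space p" and T: "T \<in> admissible_topologies p"
  obtains S and D :: "(real^'n) set" where "T = seminorm_topology p S" "S \<noteq> {}" "\<forall>\<rho>\<in>S. SC_seminorm p \<rho>"
    "countable D" "closure D = UNIV" "controls p E S (seminorms_D p D)" "controls p E (seminorms_B p) S"
proof -
  obtain D0 :: "(real^'n) set" where D0: "countable D0" "closure D0 = UNIV"
  proof -
    obtain D0 :: "(real^'n) set" where D0: "countable D0" "\<And>X. open X \<Longrightarrow> X \<noteq> {} \<Longrightarrow> \<exists>d\<in>D0. d \<in> X"
      using countable_dense_setE by blast
    have "closure D0 = UNIV"
      using D0(2)[of "- closure D0"] closure_subset[of D0] by auto
    with D0(1) show thesis by (rule that)
  qed
  consider D where "T = T_D p D" "countable D" "closure D = UNIV"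
    | \<theta> where "T = T_Theta p \<theta>" "suitable_moduli \<theta>" | "T = T_B p"
    using T unfolding admissible_topologies_def by blast
  then show thesis
  proof cases
    case (1 D)
    then have "D \<noteq> {}" by auto
    then have "seminorms_D p D \<noteq> ({} :: ((real \<times> (real^'n) \<Rightarrow> real^'m) \<Rightarrow> real) set)"
      using zero_rat_interval by (auto simp: seminorms_D_def)
    then show thesis
      using 1 seminorms_B_controls_seminorms_D[OF p E]
      by (intro that[of "seminorms_D p D" D] ballI SC_seminorm_seminorms_D[OF p] controls_refl)
        (simp_all add: T_D_def)
  next
    case (2 \<theta>)
    have "seminorms_Theta p \<theta> \<noteq> ({} :: ((real \<times> (real^'n) \<Rightarrow> real^'m) \<Rightarrow> real) set)"
      using zero_rat_interval by (auto simp: seminorms_Theta_def)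
    then show thesis
      using 2 D0 SC_seminorm_seminorms_Theta[OF p 2(2)] seminorms_Theta_controls_seminorms_D[OF p E 2(2)]
        seminorms_B_controls_seminorms_Theta[OF p E 2(2)]
      by (intro that[of "seminorms_Theta p \<theta>" D0]) (auto simp: T_Theta_def)
  next
    case 3
    have "seminorms_B p \<noteq> ({} :: ((real \<times> (real^'n) \<Rightarrow> real^'m) \<Rightarrow> real) set)"
      using zero_rat_interval by (auto simp: seminorms_B_def)
    then show thesis
      using 3 D0 seminorms_B_controls_seminorms_D[OF p E]
      by (intro that[of "seminorms_B p" D0] ballI SC_seminorm_seminorms_B[OF p] controls_refl)
        (simp_all add: T_B_def)
  qed
qed

section \<open>Coincidence of topologies and closures\<close>

theorem theorem4p12:
  fixes p :: real
    and E :: "(real \<times> (real^'n) \<Rightarrow> real^'m) set set"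
    and T1 T2 :: "(real \<times> (real^'n) \<Rightarrow> real^'m) set topology"
  assumes "1 \<le> p"
    and "E \<subseteq> LC_space p"
    and "Lploc_bounded_l_bounds p E"
    and "T1 \<in> admissible_topologies p"
    and "T2 \<in> admissible_topologies p"
  shows "subtopology T1 E = subtopology T2 E \<and> T1 closure_of E = T2 closure_of E"
proof -
  have E: "E \<subseteq> SC_space p" using assms(2) by (auto simp: LC_space_def)
  obtain S1 and D1 :: "(real^'n) set" where S1: "T1 = seminorm_topology p S1" "S1 \<noteq> {}"
      "\<forall>\<rho>\<in>S1. SC_seminorm p \<rho>" "countable D1" "closure D1 = UNIV"
      "controls p E S1 (seminorms_D p D1)" "controls p E (seminorms_B p) S1"
    by (rule admissible_family[OF assms(1) E assms(4)]) blast
  obtain S2 and D2 :: "(real^'n) set" where S2: "T2 = seminorm_topology p S2" "S2 \<noteq> {}"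
      "\<forall>\<rho>\<in>S2. SC_seminorm p \<rho>" "countable D2" "closure D2 = UNIV"
      "controls p E S2 (seminorms_D p D2)" "controls p E (seminorms_B p) S2"
    by (rule admissible_family[OF assms(1) E assms(5)]) blast
  note D_B = seminorms_D_controls_seminorms_B[OF assms(1-3)]
  have "controls p E S1 S2"
    by (rule controls_trans[OF S1(6) controls_trans[OF D_B[OF S1(4,5)] S2(7)]])
  moreover have "controls p E S2 S1"
    by (rule controls_trans[OF S2(6) controls_trans[OF D_B[OF S2(4,5)] S1(7)]])
  ultimately show ?thesis
    using subtopology_closure_eq_if_controls[OF assms(1) S1(2,3) S2(2,3) E] S1(1) S2(1) by blast
qed

end
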